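(* Let $A$ be a pro-$C^{*}$-algebra, let $E$ be a Hilbert $A$-module which is countably generated in its multiplier module $M(E)$, and let $\{h_n\}_n$ be a sequence in $M(E)$. Then $\{h_n\}_n$ is a standard normalised frame of multipliers in $E$ if and only if for all $\xi\in E$ the series $\sum_n h_n\cdot\langle h_n,\xi\rangle_{M(E)}$ converges in $E$ and moreover $$\xi=\sum_n h_n\cdot\langle h_n,\xi\rangle_{M(E)}.$$
   Context: A pro-$C^{*}$-algebra $A$ is a complete Hausdorff topological $*$-algebra over $\mathbb{C}$ whose topology is given by a directed family of $C^{*}$-seminorms; $S(A)$ is the directed set of all continuous $C^{*}$-seminorms on $A$ (no unit is assumed). A pre-Hilbert $A$-module is a complex vector space $E$ that is a right $A$-module (compatibly with the complex algebra structure) with an $A$-valued inner product $\langle\cdot,\cdot\rangle_E$, $\mathbb{C}$- and $A$-linear in the second variable, with $\langle\xi,\eta\rangle_E^{*}=\langle\eta,\xi\rangle_E$, $\langle\xi,\xi\rangle_E\ge 0$, and $\langle\xi,\xi\rangle_E=0$ iff $\xi=0$. It is a Hilbert $A$-module if it is complete for the topology given by the seminorms $\overline{p}_E(\xi)=\sqrt{p(\langle\xi,\xi\rangle_E)}$, $p\in S(A)$. $A$ itself is a Hilbert $A$-module with $\langle a,b\rangle_A=a^{*}b$. $L(E,F)$ denotes the set of adjointable module morphisms $T:E\to F$ between Hilbert $A$-modules (those having a module morphism $T^{*}:F\to E$ with $\langle T\xi,\eta\rangle_F=\langle\xi,T^{*}\eta\rangle_E$), topologized by the seminorms $\widetilde{p}_{L(E,F)}(T)=\sup\{\overline{p}_F(T\xi):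 \xi\in E,\ \overline{p}_E(\xi)\le 1\}$, $p\in S(A)$; $L(E)=L(E,E)$ is a pro-$C^{*}$-algebra. The multiplier module of $E$ is $M(E)=L(A,E)$, a Hilbert module over $M(A)=L(A)$ with action $T\cdot S=T\circ S$ and inner product $\langle T,R\rangle_{M(E)}=T^{*}\circ R$. $E$ is identified with a submodule of $M(E)$ through $\xi\mapsto(a\mapsto \xi a)$. For $h\in M(E)$, $\xi\in E$, $a\in A$: $\langle h,\xi\rangle_{M(E)}=h^{*}(\xi)\in A$, $\langle\xi,h\rangle_{M(E)}=h^{*}(\xi)^{*}$, and $h\cdot a$ is identified with $h(a)\in E$. $E$ is countably generated in $M(E)$ if there is a countable set $\{g_n\}_{n\ge1}\subseteq M(E)$ such that the closed submodule of $M(E)$ generated by $\{g_n\cdot a: a\in A,\ n=1,2,\dots\}$ is the whole of $E$. A sequence $\{h_n\}_n$ in $M(E)$ is a standard frame of multipliers in $E$ if for each $\xi\in E$ the series $\sum_n\langle\xi,h_n\rangle_{M(E)}\langle h_n,\xi\rangle_{M(E)}$ converges in $A$ and there are positive constants $C,D$ with $C\langle\xi,\xi\rangle_E\le\sum_n\langle\xi,h_n\rangle_{M(E)}\langle h_n,\xi\rangle_{M(E)}\le D\langle\xi,\xi\rangle_E$ for all $\xi\in E$. It is a standard normalised frame of multipliers if $C=D=1$. *)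

theory Defs
  imports "HOL-Analysis.Analysis"
begin

section \<open>Complex *-algebras\<close>

class scaleC =
  fixes scaleC :: "complex \<Rightarrow> 'a \<Rightarrow> 'a"  (infixr "*\<^sub>C" 75)

class complex_vector = scaleC + ab_group_add +
  assumes scaleC_add_right: "c *\<^sub>C (x + y) = c *\<^sub>C x + c *\<^sub>C y"
    and scaleC_add_left: "(c + d) *\<^sub>C x = c *\<^sub>C x + d *\<^sub>C x"
    and scaleC_scaleC: "c *\<^sub>C (d *\<^sub>C x) = (c * d) *\<^sub>C x"
    and scaleC_one: "1 *\<^sub>C x = x"

text \<open>Algebras are not assumed to have a unit.\<close>

class complex_algebra = complex_vector + ring +
  assumes mult_scaleC_left: "(c *\<^sub>C x) * y = c *\<^sub>C (x * y)"
    and mult_scaleC_right: "x * (c *\<^sub>C y) = c *\<^sub>C (x * y)"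

class complex_star_algebra = complex_algebra +
  fixes star :: "'a \<Rightarrow> 'a"
  assumes star_star: "star (star x) = x"
    and star_add: "star (x + y) = star x + star y"
    and star_scaleC: "star (c *\<^sub>C x) = cnj c *\<^sub>C star x"
    and star_mult: "star (x * y) = star y * star x"

section \<open>Pro-C*-algebras\<close>

definition (in complex_vector) seminorm :: "('a \<Rightarrow> real) \<Rightarrow> bool"
  where "seminorm p \<longleftrightarrow>
    (\<forall>x. 0 \<le> p x) \<and>
    (\<forall>x y. p (x + y) \<le> p x + p y) \<and>
    (\<forall>c x. p (c *\<^sub>C x) = cmod c * p x)"

definition (in complex_star_algebra) cstar_seminorm :: "('a \<Rightarrow> real) \<Rightarrow> bool"
  where "cstar_seminorm p \<longleftrightarrow>
    seminorm p \<and>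
    (\<forall>x y. p (x * y) \<le> p x * p y) \<and>
    (\<forall>x. p (star x) = p x) \<and>
    (\<forall>x. p (star x * x) = (p x)\<^sup>2)"

definition directed_seminorms :: "('a \<Rightarrow> real) set \<Rightarrow> bool"
  where "directed_seminorms P \<longleftrightarrow>
    P \<noteq> {} \<and> (\<forall>p\<in>P. \<forall>q\<in>P. \<exists>r\<in>P. \<forall>x. p x \<le> r x \<and> q x \<le> r x)"

text \<open>The uniformity of the group topology defined by a family of seminorms: its entourages are
  generated by the sets \<open>{(x, y). p (x - y) < e}\<close>.\<close>

definition (in ab_group_add) seminorm_uniformity :: "('a \<Rightarrow> real) set \<Rightarrow> ('a \<times> 'a) filter"
  where "seminorm_uniformity P =
    (INF p\<in>P. INF e\<in>{0<..}. principal {(x, y). p (x - y) < e})"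

text \<open>Continuity of the algebra operations is a consequence of the second axiom.\<close>

class pro_cstar_algebra = complex_star_algebra + uniform_space + t2_space +
  assumes complete_pro_cstar: "complete UNIV"
    and uniformity_cstar_seminorms:
      "\<exists>P :: ('a \<Rightarrow> real) set. directed_seminorms P \<and> (\<forall>p\<in>P. cstar_seminorm p) \<and>
         uniformity = seminorm_uniformity P"

definition continuous_cstar_seminorms :: "('a::pro_cstar_algebra \<Rightarrow> real) set"
  where "continuous_cstar_seminorms = {p. cstar_seminorm p \<and> continuous_on UNIV p}"

definition positive :: "'a::complex_star_algebra \<Rightarrow> bool"
  where "positive a \<longleftrightarrow> (\<exists>b. a = star b * b)"

definition star_le :: "'a::complex_star_algebra \<Rightarrow> 'a \<Rightarrow> bool"  (infix "\<preceq>" 50)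
  where "a \<preceq> b \<longleftrightarrow> positive (b - a)"

section \<open>Hilbert modules\<close>

definition inner_seminorm :: "('e \<Rightarrow> 'e \<Rightarrow> 'a) \<Rightarrow> ('a \<Rightarrow> real) \<Rightarrow> 'e \<Rightarrow> real"
  where "inner_seminorm inn p x = sqrt (p (inn x x))"

locale pre_hilbert_module =
  fixes act :: "'e::complex_vector \<Rightarrow> 'a::pro_cstar_algebra \<Rightarrow> 'e"
    and inn :: "'e \<Rightarrow> 'e \<Rightarrow> 'a"
  assumes act_add_left: "act (x + y) a = act x a + act y a"
    and act_add_right: "act x (a + b) = act x a + act x b"
    and act_mult: "act x (a * b) = act (act x a) b"
    and act_scaleC_left: "act (c *\<^sub>C x) a = c *\<^sub>C act x a"
    and act_scaleC_right: "act x (c *\<^sub>C a) = c *\<^sub>C act x a"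
    and inn_add_right: "inn x (y + z) = inn x y + inn x z"
    and inn_scaleC_right: "inn x (c *\<^sub>C y) = c *\<^sub>C inn x y"
    and inn_act_right: "inn x (act y a) = inn x y * a"
    and star_inn: "star (inn x y) = inn y x"
    and inn_positive: "positive (inn x x)"
    and inn_eq_0_iff: "inn x x = 0 \<longleftrightarrow> x = 0"

locale hilbert_module = pre_hilbert_module act inn
  for act :: "'e::{complex_vector, uniform_space} \<Rightarrow> 'a::pro_cstar_algebra \<Rightarrow> 'e"
    and inn :: "'e \<Rightarrow> 'e \<Rightarrow> 'a" +
  assumes uniformity_inner_seminorms:
      "uniformity = seminorm_uniformity (inner_seminorm inn ` continuous_cstar_seminorms)"
    and complete_module: "complete (UNIV :: 'e set)"

text \<open>The algebra as a module over itself has action \<^term>\<open>(*)\<close> and the following inner product.\<close>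

definition alg_inn :: "'a::complex_star_algebra \<Rightarrow> 'a \<Rightarrow> 'a"
  where "alg_inn a b = star a * b"

section \<open>Adjointable operators\<close>

definition module_morphism ::
    "('e::complex_vector \<Rightarrow> 'a \<Rightarrow> 'e) \<Rightarrow> ('f::complex_vector \<Rightarrow> 'a \<Rightarrow> 'f) \<Rightarrow> ('e \<Rightarrow> 'f) \<Rightarrow> bool"
  where "module_morphism actE actF T \<longleftrightarrow>
    (\<forall>x y. T (x + y) = T x + T y) \<and>
    (\<forall>c x. T (c *\<^sub>C x) = c *\<^sub>C T x) \<and>
    (\<forall>x a. T (actE x a) = actF (T x) a)"

definition is_adjoint ::
    "('e::complex_vector \<Rightarrow> 'a \<Rightarrow> 'e) \<Rightarrow> ('e \<Rightarrow> 'e \<Rightarrow> 'a) \<Rightarrow>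
     ('f::complex_vector \<Rightarrow> 'a \<Rightarrow> 'f) \<Rightarrow> ('f \<Rightarrow> 'f \<Rightarrow> 'a) \<Rightarrow> ('e \<Rightarrow> 'f) \<Rightarrow> ('f \<Rightarrow> 'e) \<Rightarrow> bool"
  where "is_adjoint actE innE actF innF T S \<longleftrightarrow>
    module_morphism actF actE S \<and> (\<forall>x y. innF (T x) y = innE x (S y))"

definition adjointable_ops ::
    "('e::complex_vector \<Rightarrow> 'a \<Rightarrow> 'e) \<Rightarrow> ('e \<Rightarrow> 'e \<Rightarrow> 'a) \<Rightarrow>
     ('f::complex_vector \<Rightarrow> 'a \<Rightarrow> 'f) \<Rightarrow> ('f \<Rightarrow> 'f \<Rightarrow> 'a) \<Rightarrow> ('e \<Rightarrow> 'f) set"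
  where "adjointable_ops actE innE actF innF =
    {T. module_morphism actE actF T \<and> (\<exists>S. is_adjoint actE innE actF innF T S)}"

text \<open>The adjoint is unique for Hilbert modules, because their inner products are definite.\<close>

definition adjoint ::
    "('e::complex_vector \<Rightarrow> 'a \<Rightarrow> 'e) \<Rightarrow> ('e \<Rightarrow> 'e \<Rightarrow> 'a) \<Rightarrow>
     ('f::complex_vector \<Rightarrow> 'a \<Rightarrow> 'f) \<Rightarrow> ('f \<Rightarrow> 'f \<Rightarrow> 'a) \<Rightarrow> ('e \<Rightarrow> 'f) \<Rightarrow> 'f \<Rightarrow> 'e"
  where "adjoint actE innE actF innF T = (THE S. is_adjoint actE innE actF innF T S)"

text \<open>The supremum is finite for adjointable operators between Hilbert modules and continuous
  C*-seminorms \<open>p\<close>.\<close>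

definition op_seminorm ::
    "('e \<Rightarrow> 'e \<Rightarrow> 'a) \<Rightarrow> ('f \<Rightarrow> 'f \<Rightarrow> 'a) \<Rightarrow> ('a \<Rightarrow> real) \<Rightarrow> ('e \<Rightarrow> 'f) \<Rightarrow> real"
  where "op_seminorm innE innF p T =
    (SUP x\<in>{x. inner_seminorm innE p x \<le> 1}. inner_seminorm innF p (T x))"

section \<open>The multiplier module\<close>

definition multiplier_algebra :: "('a::pro_cstar_algebra \<Rightarrow> 'a) set"
  where "multiplier_algebra = adjointable_ops (*) alg_inn (*) alg_inn"

definition multiplier_module ::
    "('e::complex_vector \<Rightarrow> 'a::pro_cstar_algebra \<Rightarrow> 'e) \<Rightarrow> ('e \<Rightarrow> 'e \<Rightarrow> 'a) \<Rightarrow> ('a \<Rightarrow> 'e) set"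
  where "multiplier_module act inn = adjointable_ops (*) alg_inn act inn"

text \<open>The topology of the operator seminorms, on the carrier \<^term>\<open>multiplier_module act inn\<close>
  (it is not the product topology of the function type).\<close>

definition multiplier_topology ::
    "('e::complex_vector \<Rightarrow> 'a::pro_cstar_algebra \<Rightarrow> 'e) \<Rightarrow> ('e \<Rightarrow> 'e \<Rightarrow> 'a) \<Rightarrow> ('a \<Rightarrow> 'e) topology"
  where "multiplier_topology act inn = topology_generated_by
    {{R \<in> multiplier_module act inn. op_seminorm alg_inn inn p (\<lambda>a. R a - T a) < e} | T p e.
      T \<in> multiplier_module act inn \<and> p \<in> continuous_cstar_seminorms \<and> 0 < e}"

text \<open>Submodules for the action of the multiplier algebra by composition.\<close>

definition multiplier_submodule ::
    "('e::complex_vector \<Rightarrow> 'a::pro_cstar_algebra \<Rightarrow> 'e) \<Rightarrow> ('e \<Rightarrow> 'e \<Rightarrow> 'a) \<Rightarrow> ('a \<Rightarrow> 'e) set \<Rightarrow> bool"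
  where "multiplier_submodule act inn N \<longleftrightarrow>
    N \<subseteq> multiplier_module act inn \<and>
    (\<lambda>a. 0) \<in> N \<and>
    (\<forall>T\<in>N. \<forall>R\<in>N. (\<lambda>a. T a + R a) \<in> N) \<and>
    (\<forall>c. \<forall>T\<in>N. (\<lambda>a. c *\<^sub>C T a) \<in> N) \<and>
    (\<forall>T\<in>N. \<forall>S\<in>multiplier_algebra. T \<circ> S \<in> N)"

definition closed_submodule_generated ::
    "('e::complex_vector \<Rightarrow> 'a::pro_cstar_algebra \<Rightarrow> 'e) \<Rightarrow> ('e \<Rightarrow> 'e \<Rightarrow> 'a) \<Rightarrow>
     ('a \<Rightarrow> 'e) set \<Rightarrow> ('a \<Rightarrow> 'e) set"
  where "closed_submodule_generated act inn G =
    \<Inter>{N. multiplier_submodule act inn N \<and> closedin (multiplier_topology act inn) N \<and> G \<subseteq> N}"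

definition module_embedding :: "('e \<Rightarrow> 'a \<Rightarrow> 'e) \<Rightarrow> 'e \<Rightarrow> ('a \<Rightarrow> 'e)"
  where "module_embedding act x = (\<lambda>a. act x a)"

text \<open>The product of a multiplier \<open>g\<close> with \<open>a\<close> is the element \<open>g a\<close> of the module, here viewed
  in the multiplier module. A sequence may repeat its terms, so finite generating sets are
  included.\<close>

definition countably_generated_in_multipliers ::
    "('e::complex_vector \<Rightarrow> 'a::pro_cstar_algebra \<Rightarrow> 'e) \<Rightarrow> ('e \<Rightarrow> 'e \<Rightarrow> 'a) \<Rightarrow> bool"
  where "countably_generated_in_multipliers act inn \<longleftrightarrow>
    (\<exists>g :: nat \<Rightarrow> 'a \<Rightarrow> 'e.
      (\<forall>n. g n \<in> multiplier_module act inn) \<and>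
      closed_submodule_generated act inn {module_embedding act (g n a) | n a. True} =
        range (module_embedding act))"

text \<open>The inner product of a multiplier \<open>h\<close> with an element \<open>x\<close> of the module, in this order; it
  is an element of the algebra, and the one in the other order is its adjoint.\<close>

definition multiplier_inn ::
    "('e::complex_vector \<Rightarrow> 'a::pro_cstar_algebra \<Rightarrow> 'e) \<Rightarrow> ('e \<Rightarrow> 'e \<Rightarrow> 'a) \<Rightarrow>
     ('a \<Rightarrow> 'e) \<Rightarrow> 'e \<Rightarrow> 'a"
  where "multiplier_inn act inn h x = adjoint (*) alg_inn act inn h x"

section \<open>Frames of multipliers\<close>

definition frame_with_bounds ::
    "('e::complex_vector \<Rightarrow> 'a::pro_cstar_algebra \<Rightarrow> 'e) \<Rightarrow> ('e \<Rightarrow> 'e \<Rightarrow> 'a) \<Rightarrow>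
     real \<Rightarrow> real \<Rightarrow> (nat \<Rightarrow> 'a \<Rightarrow> 'e) \<Rightarrow> bool"
  where "frame_with_bounds act inn C D h \<longleftrightarrow>
    (\<forall>n. h n \<in> multiplier_module act inn) \<and> 0 < C \<and> 0 < D \<and>
    (\<forall>x. summable (\<lambda>n. star (multiplier_inn act inn (h n) x) * multiplier_inn act inn (h n) x)) \<and>
    (\<forall>x. complex_of_real C *\<^sub>C inn x x
           \<preceq> (\<Sum>n. star (multiplier_inn act inn (h n) x) * multiplier_inn act inn (h n) x) \<and>
         (\<Sum>n. star (multiplier_inn act inn (h n) x) * multiplier_inn act inn (h n) x)
           \<preceq> complex_of_real D *\<^sub>C inn x x)"

definition standard_frame_of_multipliers ::
    "('e::complex_vector \<Rightarrow> 'a::pro_cstar_algebra \<Rightarrow> 'e) \<Rightarrow> ('e \<Rightarrow> 'e \<Rightarrow> 'a) \<Rightarrow>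
     (nat \<Rightarrow> 'a \<Rightarrow> 'e) \<Rightarrow> bool"
  where "standard_frame_of_multipliers act inn h \<longleftrightarrow> (\<exists>C D. frame_with_bounds act inn C D h)"

definition standard_normalised_frame_of_multipliers ::
    "('e::complex_vector \<Rightarrow> 'a::pro_cstar_algebra \<Rightarrow> 'e) \<Rightarrow> ('e \<Rightarrow> 'e \<Rightarrow> 'a) \<Rightarrow>
     (nat \<Rightarrow> 'a \<Rightarrow> 'e) \<Rightarrow> bool"
  where "standard_normalised_frame_of_multipliers act inn h \<longleftrightarrow> frame_with_bounds act inn 1 1 h"

end

theory Submission
  imports Defs
begin

text \<open>Let \<open>T\<^sub>N \<xi> = \<Sum>n<N. h\<^sub>n \<langle>h\<^sub>n, \<xi>\<rangle>\<close>, so that \<open>\<langle>T\<^sub>N \<xi>, \<xi>\<rangle> = \<Sum>n<N. \<langle>\<xi>, h\<^sub>n\<rangle> \<langle>h\<^sub>n, \<xi>\<rangle>\<close>. If \<open>T\<^sub>N \<xi>\<close> converges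
  to \<open>\<xi>\<close>, then the inner products converge to \<open>\<langle>\<xi>, \<xi>\<rangle>\<close> by Cauchy-Schwarz. Conversely, for a normalised
  frame \<open>0 \<le> T\<^sub>N \<le> 1\<close>, hence \<open>p \<langle>(1 - T\<^sub>N) \<xi>, (1 - T\<^sub>N) \<xi>\<rangle> \<le> p \<langle>(1 - T\<^sub>N) \<xi>, \<xi>\<rangle>\<close> for every continuous
  C*-seminorm \<open>p\<close>, and the right-hand side tends to 0. Both directions only need, for one
  C*-seminorm at a time, the elementary order theory of C*-algebras: sums of elements \<open>b\<^sup>* b\<close> form a
  proper cone on which \<open>p\<close> is monotone. This is obtained without completeness and without a
  functional calculus, from norm approximations by polynomials.\<close>

section \<open>Positivity in unital algebras with a C*-seminorm\<close>

text \<open>Replaces the spectral radius formula: if \<open>a / T\<close> exceeded 1, its powers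
  would outgrow every linear function of the exponent. The exponents are restricted to
  \<open>2 ^ m\<close> because \<open>q_power_two_power\<close> computes the norms of these
  powers.\<close>

lemma power_le_linear_imp_le:
  fixes a T C :: real
  assumes "0 < T" and le: "\<And>m::nat. a ^ (2 ^ m) \<le> T ^ (2 ^ m) * (1 + real (2 ^ m) * C)"
  shows "a \<le> T"
proof (rule ccontr)
  assume "\<not> a \<le> T"
  define x where "x = a / T"
  have x: "1 < x"
    using \<open>\<not> a \<le> T\<close> \<open>0 < T\<close> by (simp add: x_def)
  have xle: "1 \<le> 1 / x ^ (2 ^ m) + real (2 ^ m) / x ^ (2 ^ m) * C" for m :: nat
  proof -
    have "x ^ (2 ^ m) \<le> 1 + real (2 ^ m) * C"
      using le [of m] \<open>0 < T\<close> by (simp add: x_def power_divide field_simps)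
    then show ?thesis
      using x by (simp add: field_simps)
  qed
  have "(\<lambda>n. 1 / x ^ n) \<longlonglongrightarrow> 0"
    using x by (simp add: LIMSEQ_inverse_realpow_zero divide_inverse)
  moreover have "(\<lambda>n. real n / x ^ n) \<longlonglongrightarrow> 0"
    using lim_n_over_pown [of x] x by simp
  ultimately have "(\<lambda>n. 1 / x ^ n + real n / x ^ n * C) \<longlonglongrightarrow> 0 + 0 * C"
    by (intro tendsto_intros)
  then have "\<forall>\<^sub>F n in sequentially. 1 / x ^ n + real n / x ^ n * C < 1"
    by (intro order_tendstoD) auto
  then obtain N where N: "\<And>n. N \<le> n \<Longrightarrow> 1 / x ^ n + real n / x ^ n * C < 1"
    by (auto simp: eventually_sequentially)
  show False
    using N [of "2 ^ N"] xle [of N] less_exp [of N] by linarith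
qed

text \<open>The central element \<open>iu\<close> stands in for the imaginary unit, so that a
  complex algebra fits the real class \<open>real_algebra_1\<close>.\<close>

locale unital_cstar_seminormed_algebra =
  fixes adj :: "'b::real_algebra_1 \<Rightarrow> 'b" and q :: "'b \<Rightarrow> real" and iu :: 'b
  assumes adj_adj [simp]: "adj (adj x) = x"
    and adj_add [simp]: "adj (x + y) = adj x + adj y"
    and adj_scaleR [simp]: "adj (r *\<^sub>R x) = r *\<^sub>R adj x"
    and adj_mult [simp]: "adj (x * y) = adj y * adj x"
    and iu_square: "iu * iu = -1"
    and iu_commute: "iu * x = x * iu"
    and adj_iu: "adj iu = - iu"
    and q_add: "q (x + y) \<le> q x + q y"
    and q_scaleR [simp]: "q (r *\<^sub>R x) = \<bar>r\<bar> * q x"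
    and q_mult: "q (x * y) \<le> q x * q y"
    and q_adj [simp]: "q (adj x) = q x"
    and q_cstar: "q (adj x * x) = (q x)\<^sup>2"
begin

text \<open>The norm characterisation of positivity: in a C*-algebra it says that the spectrum of
  the self-adjoint \<open>h\<close> lies within distance \<open>t\<close> of \<open>t\<close>, hence
  in [0, 2t].\<close>

definition pos :: "'b \<Rightarrow> bool"
  where "pos h \<longleftrightarrow> adj h = h \<and> (\<exists>t\<ge>0. q (of_real t - h) \<le> t)"

section \<open>Arithmetic of the involution and the seminorm\<close>

lemma adj_zero [simp]: "adj 0 = 0"
  using adj_scaleR [of 0 0] by simp

lemma adj_minus [simp]: "adj (- x) = - adj x"
  using adj_scaleR [of "-1" x] by simp

lemma adj_diff [simp]: "adj (x - y) = adj x - adj y"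
  using adj_add [of x "- y"] by simp

lemma adj_one [simp]: "adj 1 = 1"
  by (metis adj_adj adj_mult mult_1_left mult_1_right)

lemma adj_of_real [simp]: "adj (of_real r) = of_real r"
  by (simp add: of_real_def)

lemma q_zero [simp]: "q 0 = 0"
  using q_scaleR [of 0 0] by simp

lemma q_minus [simp]: "q (- x) = q x"
  using q_scaleR [of "-1" x] by simp

lemma q_ge_0 [simp]: "0 \<le> q x"
  using q_add [of x "- x"] by simp

lemma q_diff: "q (x - y) \<le> q x + q y"
  using q_add [of x "- y"] by simp

lemma q_diff_commute: "q (x - y) = q (y - x)"
  using q_minus [of "x - y"] by simp

lemma q_triangle: "q x \<le> q (x - y) + q y"
  using q_add [of "x - y" y] by simp

lemma q_one_le: "q 1 \<le> 1"
proof -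
  have "q 1 * q 1 = q 1 * 1"
    using q_cstar [of 1] by (simp add: power2_eq_square)
  then show ?thesis
    by (metis linear mult_cancel_left zero_less_one_class.zero_le_one)
qed

lemma q_of_real_le: "q (of_real r) \<le> \<bar>r\<bar>"
  unfolding of_real_def using mult_left_mono [OF q_one_le, of "\<bar>r\<bar>"] by simp

lemma q_square: "adj x = x \<Longrightarrow> q (x * x) = (q x)\<^sup>2"
  using q_cstar [of x] by simp

text \<open>The normal element \<open>z = x + iu * y\<close> satisfies
  \<open>adj z * z = x * x + y * y\<close>, and \<open>x\<close> is its real part, so
  \<open>q x \<le> q z\<close>.\<close>

lemma q_commuting_squares:
  assumes "adj x = x" "adj y = y" "x * y = y * x"
  shows "(q x)\<^sup>2 \<le> q (x * x + y * y)"
proof -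
  define z where "z = x + iu * y"
  have az: "adj z = x - iu * y"
    by (simp add: z_def assms adj_iu iu_commute [of y])
  have iuy: "iu * y * (iu * y) = - (y * y)"
  proof -
    have "iu * y * (iu * y) = iu * (y * iu) * y"
      by (simp add: mult.assoc)
    also have "\<dots> = iu * iu * (y * y)"
      by (simp only: iu_commute [of y, symmetric] mult.assoc)
    finally show ?thesis
      by (simp add: iu_square)
  qed
  have xy: "x * (iu * y) = iu * y * x"
  proof -
    have "x * (iu * y) = iu * x * y"
      by (simp only: iu_commute [of x] mult.assoc)
    then show ?thesis
      by (simp only: assms(3) mult.assoc)
  qed
  have "adj z * z = x * x + x * (iu * y) - iu * y * x - iu * y * (iu * y)"
    unfolding az by (simp add: z_def distrib_left left_diff_distrib)
  then have "adj z * z = x * x + y * y"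
    by (simp only: xy iuy) simp
  then have "q (x * x + y * y) = (q z)\<^sup>2"
    using q_cstar [of z] by simp
  moreover have "q x \<le> q z"
  proof -
    have "2 *\<^sub>R x = z + adj z"
      unfolding az by (simp add: z_def scaleR_2)
    then have "2 * q x = q (z + adj z)"
      using q_scaleR [of 2 x] by simp
    then show ?thesis
      using q_add [of z "adj z"] by simp
  qed
  ultimately show ?thesis
    by (simp add: power_mono)
qed

text \<open>The iteration \<open>w \<mapsto> (z + w\<^sup>2) / 2\<close> approximates \<open>1 - sqrt (1 - z)\<close> in norm,
  so no completeness is needed.\<close>

lemma approximate_sqrt_near_one:
  assumes k: "adj k = k" and \<theta>: "q (1 - k) \<le> \<theta>" "\<theta> < 1" and "0 < e"
  obtains r where "adj r = r" "\<And>y. y * k = k * y \<Longrightarrow> y * r = r * y"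
    "q (r * r - k) < e" "q (1 - r) \<le> 1"
proof -
  define z where "z = 1 - k"
  define w where "w = rec_nat 0 (\<lambda>_ x. (1/2) *\<^sub>R (z + x * x))"
  have w0: "w 0 = 0" and wS: "w (Suc n) = (1/2) *\<^sub>R (z + w n * w n)" for n
    by (simp_all add: w_def)
  have \<theta>0: "0 \<le> \<theta>"
    using \<theta> q_ge_0 order_trans by blast
  have aw: "adj (w n) = w n" for n
    by (induction n) (simp_all add: w0 wS z_def k)
  have cw: "y * w n = w n * y" if "y * k = k * y" for y n
  proof (induction n)
    case (Suc n)
    have "y * (w n * w n) = w n * w n * y"
      by (metis Suc mult.assoc)
    moreover have "y * z = z * y"
      using that by (simp add: z_def algebra_simps)
    ultimately show ?case
      by (simp add: wS distrib_left distrib_right)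
  qed (simp add: w0)
  have cww: "w m * w n = w n * w m" for m n
    by (rule cw, rule sym, rule cw) simp
  have qw: "q (w n) \<le> \<theta>" for n
  proof (induction n)
    case (Suc n)
    have "q (w n * w n) \<le> \<theta> * \<theta>"
      using q_mult [of "w n" "w n"] mult_mono [OF Suc Suc \<theta>0] by simp
    moreover have "\<theta> * \<theta> \<le> \<theta>"
      using \<theta> \<theta>0 mult_left_le [of \<theta> \<theta>] by simp
    ultimately have "q (z + w n * w n) \<le> 2 * \<theta>"
      using q_add [of z "w n * w n"] \<theta>(1) by (simp add: z_def)
    then show ?case
      by (simp add: wS)
  qed (simp add: w0 \<theta>0)
  have dw: "q (w (Suc n) - w n) \<le> \<theta> ^ n" for n
  proof (induction n)
    case 0
    then show ?case
      using qw [of 1] \<theta>(2) by (simp add: w0)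
  next
    case (Suc n)
    \<comment> \<open>The iterates commute, so the difference of their squares factors; as both have
      norm at most \<theta>, each step contracts by the factor \<theta>.\<close>
    have "w (Suc (Suc n)) - w (Suc n)
        = (1/2) *\<^sub>R (z + w (Suc n) * w (Suc n)) - (1/2) *\<^sub>R (z + w n * w n)"
      using wS [of "Suc n"] wS [of n] by metis
    also have "\<dots> = (1/2) *\<^sub>R ((w (Suc n) - w n) * (w (Suc n) + w n))"
      by (simp add: algebra_simps cww [of n "Suc n"])
    finally have "w (Suc (Suc n)) - w (Suc n)
        = (1/2) *\<^sub>R ((w (Suc n) - w n) * (w (Suc n) + w n))" .
    then have "q (w (Suc (Suc n)) - w (Suc n))
        \<le> (1/2) * (q (w (Suc n) - w n) * q (w (Suc n) + w n))"
      using q_mult by simp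
    also have "\<dots> \<le> (1/2) * (\<theta> ^ n * (2 * \<theta>))"
      using q_add [of "w (Suc n)" "w n"] qw [of n] qw [of "Suc n"] Suc \<theta>0
      by (intro mult_left_mono mult_mono) auto
    finally show ?case
      by (simp add: mult.commute)
  qed
  have "(\<lambda>n. \<theta> ^ n) \<longlonglongrightarrow> 0"
    using \<theta> \<theta>0 by (intro LIMSEQ_power_zero) simp
  then have "\<forall>\<^sub>F n in sequentially. \<theta> ^ n < e / 2"
    using \<open>0 < e\<close> by (intro order_tendstoD) auto
  then obtain n where n: "\<theta> ^ n < e / 2"
    using eventually_happens by force
  \<comment> \<open>The error of \<open>1 - w n\<close> as a square root of \<open>k\<close> is
    twice the increment of the iteration.\<close>
  have "(1 - w n) * (1 - w n) - k = 2 *\<^sub>R (w (Suc n) - w n)"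
    by (simp add: wS z_def algebra_simps scaleR_2)
  then have near: "q ((1 - w n) * (1 - w n) - k) < e"
    using dw [of n] n by simp
  have le: "q (1 - (1 - w n)) \<le> 1"
    using qw [of n] \<theta>(2) by simp
  have comm: "y * (1 - w n) = (1 - w n) * y" if "y * k = k * y" for y
    using cw [OF that, of n] by (simp add: left_diff_distrib right_diff_distrib)
  have "adj (1 - w n) = 1 - w n"
    by (simp add: aw)
  from that [OF this comm near le] show thesis .
qed

text \<open>With \<open>a = r * r\<close>, the identity
  \<open>(1 - a)\<^sup>2 + 2 a (1 - a / 2) = 1\<close> suggests taking for \<open>y\<close> an
  approximate square root of the second summand. Then \<open>1 - a\<close> and \<open>y\<close>
  commute and their squares sum to nearly 1, so \<open>q_commuting_squares\<close> applies.\<close>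

lemma q_one_diff_square:
  assumes r: "adj r = r" and "q r \<le> 1"
  shows "q (1 - r * r) \<le> 1"
proof -
  have "(q (1 - r * r))\<^sup>2 \<le> 1 + e" if "0 < e" for e
  proof -
    define k where "k = 1 - (1/2) *\<^sub>R (r * r)"
    have "(q r)\<^sup>2 \<le> 1"
      using assms(2) by (simp add: power_le_one)
    then have "q (1 - k) \<le> 1/2"
      by (simp add: k_def q_square r)
    moreover have "adj k = k"
      by (simp add: k_def r)
    moreover have "(1/2 :: real) < 1" "0 < e / 2"
      using \<open>0 < e\<close> by simp_all
    ultimately obtain s where s: "adj s = s" "\<And>y. y * k = k * y \<Longrightarrow> y * s = s * y"
      "q (s * s - k) < e / 2"
      using approximate_sqrt_near_one by blast
    have rs: "r * s = s * r"
      by (rule s(2)) (simp add: k_def algebra_simps)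
    define y where "y = sqrt 2 *\<^sub>R (r * s)"
    have "(q (1 - r * r))\<^sup>2 \<le> q ((1 - r * r) * (1 - r * r) + y * y)"
    proof (rule q_commuting_squares)
      have "r * r * (r * s) = r * s * (r * r)"
        by (metis rs mult.assoc)
      then show "(1 - r * r) * y = y * (1 - r * r)"
        by (simp add: y_def algebra_simps)
    qed (simp_all add: y_def r s rs)
    also have "(1 - r * r) * (1 - r * r) + y * y = 1 + 2 *\<^sub>R (r * r * (s * s - k))"
    proof -
      have "y * y = 2 *\<^sub>R (r * r * (s * s))"
        unfolding y_def by simp (metis rs mult.assoc)
      moreover have "r * r * k + r * r * k = r * r + r * r - r * r * (r * r)"
      proof -
        have "r * r * k + r * r * k = 2 *\<^sub>R (r * r - (1/2) *\<^sub>R (r * r * (r * r)))"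
          by (simp add: k_def right_diff_distrib scaleR_2)
        then show ?thesis
          by (simp add: scaleR_diff_right scaleR_2)
      qed
      ultimately show ?thesis
        by (simp add: algebra_simps scaleR_2)
    qed
    also have "q \<dots> \<le> 1 + 2 * (1 * (e / 2))"
    proof -
      have "q (r * r * (s * s - k)) \<le> q (r * r) * q (s * s - k)"
        by (rule q_mult)
      also have "\<dots> \<le> 1 * (e / 2)"
        using s(3) \<open>(q r)\<^sup>2 \<le> 1\<close> by (intro mult_mono) (auto simp: q_square r)
      finally show ?thesis
        using q_add [of 1 "2 *\<^sub>R (r * r * (s * s - k))"] q_one_le by simp
    qed
    finally show ?thesis
      by simp
  qed
  then have "(q (1 - r * r))\<^sup>2 \<le> 1"
    by (rule field_le_epsilon)
  then show ?thesis
    by (simp add: power_le_one_iff)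
qed

lemma q_of_real_diff_square:
  assumes r: "adj r = r" and "(q r)\<^sup>2 \<le> t" "0 < t"
  shows "q (of_real t - r * r) \<le> t"
proof -
  define x where "x = (1 / sqrt t) *\<^sub>R r"
  have "q r \<le> sqrt t"
    using assms(2) real_le_rsqrt by blast
  then have "q (1 - x * x) \<le> 1"
    using assms by (intro q_one_diff_square) (simp_all add: x_def)
  moreover have "of_real t - r * r = t *\<^sub>R (1 - x * x)"
    using \<open>0 < t\<close> by (simp add: x_def algebra_simps of_real_def)
  ultimately show ?thesis
    using \<open>0 < t\<close> by (simp add: mult_left_le)
qed

section \<open>The positive cone and monotonicity of the seminorm on it\<close>

lemma pos_adj: "pos h \<Longrightarrow> adj h = h"
  by (simp add: pos_def)

lemma pos_square: "adj r = r \<Longrightarrow> pos (r * r)"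
  unfolding pos_def using q_of_real_diff_square [of r "(q r)\<^sup>2 + 1"]
  by (intro conjI exI [of _ "(q r)\<^sup>2 + 1"]) (simp_all add: add_nonneg_pos del: of_real_add)

lemma pos_add: "pos h \<Longrightarrow> pos k \<Longrightarrow> pos (h + k)"
proof -
  assume "pos h" "pos k"
  then obtain t s where ts: "0 \<le> t" "q (of_real t - h) \<le> t" "0 \<le> s" "q (of_real s - k) \<le> s"
    by (auto simp: pos_def)
  have eq: "of_real (t + s) - (h + k) = (of_real t - h) + (of_real s - k)"
    by simp
  have "q (of_real (t + s) - (h + k)) \<le> t + s"
    unfolding eq using q_add [of "of_real t - h" "of_real s - k"] ts by linarith
  then show ?thesis
    using \<open>pos h\<close> \<open>pos k\<close> ts unfolding pos_def by (auto intro!: exI [of _ "t + s"])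
qed

lemma pos_scaleR:
  assumes "pos h" "0 \<le> c"
  shows "pos (c *\<^sub>R h)"
proof -
  obtain t where t: "0 \<le> t" "q (of_real t - h) \<le> t"
    using assms by (auto simp: pos_def)
  have "of_real (c * t) - c *\<^sub>R h = c *\<^sub>R (of_real t - h)"
    by (simp add: algebra_simps of_real_def)
  then have "q (of_real (c * t) - c *\<^sub>R h) \<le> c * t"
    using t assms by (simp add: mult_left_mono)
  then show ?thesis
    using assms t unfolding pos_def by (auto intro!: exI [of _ "c * t"])
qed

lemma pos_of_real_diff:
  assumes "adj c = c" "q c \<le> t"
  shows "pos (of_real t - c)"
  using assms order_trans [OF q_ge_0 [of c]] unfolding pos_def by (auto intro!: exI [of _ t])

text \<open>Shifting \<open>h\<close> by the small amount \<open>d\<close> and dividing by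
  \<open>t + d\<close> moves it within distance \<open>t / (t + d) < 1\<close> of the unit, where an
  approximate root exists. The commutation clause imitates a root given by functional
  calculus.\<close>

lemma pos_approximate_square:
  assumes h: "pos h" and "0 < e"
  obtains r where "adj r = r" "pos r" "\<And>y. y * h = h * y \<Longrightarrow> y * r = r * y"
    "q (r * r - h) < e"
proof -
  obtain t where t: "0 \<le> t" "q (of_real t - h) \<le> t"
    using h by (auto simp: pos_def)
  define d where "d = e / 2"
  have d: "0 < d" "0 < t + d"
    using \<open>0 < e\<close> t by (auto simp: d_def)
  define k where "k = (1 / (t + d)) *\<^sub>R (h + of_real d)"
  have ak: "adj k = k"
    by (simp add: k_def pos_adj h)
  have hk: "(t + d) *\<^sub>R k = h + of_real d"
    using d by (simp add: k_def)
  have "(t + d) *\<^sub>R (1 - k) = of_real t - h"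
    unfolding scaleR_diff_right hk by (simp add: of_real_def algebra_simps)
  then have "(t + d) * q (1 - k) \<le> t"
    using q_scaleR [of "t + d" "1 - k"] d t by simp
  then have "q (1 - k) \<le> t / (t + d)" "t / (t + d) < 1" "0 < d / (t + d)"
    using d by (simp_all add: field_simps)
  note sqrt_exists = approximate_sqrt_near_one [OF ak this]
  obtain s where s: "adj s = s" "\<And>y. y * k = k * y \<Longrightarrow> y * s = s * y"
      "q (s * s - k) < d / (t + d)" "q (1 - s) \<le> 1"
    by (rule sqrt_exists, rule that)
  have "pos s"
    using s(1,4) unfolding pos_def by (auto intro!: exI [of _ 1])
  define r where "r = sqrt (t + d) *\<^sub>R s"
  have "r * r - h = (t + d) *\<^sub>R (s * s - k) + of_real d"
    using d hk by (simp add: r_def algebra_simps)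
  then have "q (r * r - h) \<le> (t + d) * q (s * s - k) + d"
    using q_add [of "(t + d) *\<^sub>R (s * s - k)" "of_real d"] q_of_real_le [of d] d by simp
  also have "\<dots> < e"
    using s(3) d by (simp add: d_def field_simps)
  finally have "q (r * r - h) < e" .
  moreover have "y * r = r * y" if "y * h = h * y" for y
  proof -
    have "y * k = k * y"
      using that by (simp add: k_def algebra_simps of_real_def)
    then show ?thesis
      by (simp add: r_def s(2))
  qed
  moreover have "adj r = r" "pos r"
    using s(1) \<open>pos s\<close> d by (simp_all add: r_def pos_scaleR)
  ultimately show thesis
    by (blast intro: that)
qed

text \<open>Makes the witness in \<open>pos\<close> canonical: the definition provides one bound,
  possibly far above \<open>q h\<close>. Approximation reduces the claim to squares.\<close>

lemma q_of_real_diff_pos: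
  assumes h: "pos h" and "q h \<le> t"
  shows "q (of_real t - h) \<le> t"
proof (rule field_le_epsilon)
  fix e :: real
  assume "0 < e"
  then have "0 < e / 3"
    by simp
  then obtain r where r: "adj r = r" "q (r * r - h) < e / 3"
    using pos_approximate_square [OF h] by blast
  define s where "s = t + e / 3"
  have "(q r)\<^sup>2 \<le> s"
    using q_triangle [of "r * r" h] r assms(2) by (simp add: q_square s_def)
  moreover have "0 < s"
    using assms(2) q_ge_0 [of h] \<open>0 < e\<close> unfolding s_def by linarith
  ultimately have "q (of_real s - r * r) \<le> s"
    using q_of_real_diff_square r(1) by blast
  moreover have eq: "of_real t - h = (of_real s - r * r) + ((r * r - h) - of_real (e / 3))"
    by (simp add: s_def)
  ultimately have "q (of_real t - h) \<le> s + (e / 3 + e / 3)"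
    unfolding eq using q_add [of "of_real s - r * r" "(r * r - h) - of_real (e / 3)"]
      q_diff [of "r * r - h" "of_real (e / 3)"] q_of_real_le [of "e / 3"] r(2) \<open>0 < e\<close>
    by linarith
  then show "q (of_real t - h) \<le> t + e"
    by (simp add: s_def)
qed

text \<open>By \<open>q_of_real_diff_pos\<close> the witness for an approximant \<open>b\<close> may
  be taken close to \<open>q a\<close>, so the bounds pass to the limit.\<close>

lemma pos_closed:
  assumes a: "adj a = a" and approx: "\<And>e. 0 < e \<Longrightarrow> \<exists>b. pos b \<and> q (a - b) < e"
  shows "pos a"
proof -
  have "q (of_real (q a) - a) \<le> q a"
  proof (rule field_le_epsilon)
    fix e :: real
    assume "0 < e"
    then obtain b where b: "pos b" "q (a - b) < e / 3"
      using approx [of "e / 3"] by auto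
    have "q b \<le> q a + e / 3"
      using q_triangle [of b a] b q_diff_commute [of a b] by simp
    then have "q (of_real (q a + e / 3) - b) \<le> q a + e / 3"
      using q_of_real_diff_pos b by blast
    moreover have eq: "of_real (q a) - a
        = (of_real (q a + e / 3) - b) - ((a - b) + of_real (e / 3))"
      by simp
    ultimately show "q (of_real (q a) - a) \<le> q a + e"
      unfolding eq using q_diff [of "of_real (q a + e / 3) - b" "(a - b) + of_real (e / 3)"]
        q_add [of "a - b" "of_real (e / 3)"] q_of_real_le [of "e / 3"] b(2) \<open>0 < e\<close>
      by linarith
  qed
  then show ?thesis
    unfolding pos_def using a q_ge_0 by blast
qed

text \<open>Approximate square roots of \<open>a\<close> and \<open>b\<close> commute with each
  other, which reduces the claim to \<open>q_commuting_squares\<close>.\<close>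

lemma q_le_commuting_pos_add:
  assumes a: "pos a" and b: "pos b" and ab: "a * b = b * a"
  shows "q a \<le> q (a + b)"
proof (rule field_le_epsilon)
  fix e :: real
  assume "0 < e"
  then have "0 < e / 3"
    by simp
  obtain r where r: "adj r = r" "\<And>y. y * a = a * y \<Longrightarrow> y * r = r * y" "q (r * r - a) < e / 3"
    by (rule pos_approximate_square [OF a \<open>0 < e / 3\<close>], rule that)
  obtain s where s: "adj s = s" "\<And>y. y * b = b * y \<Longrightarrow> y * s = s * y" "q (s * s - b) < e / 3"
    by (rule pos_approximate_square [OF b \<open>0 < e / 3\<close>], rule that)
  have "s * r = r * s"
    by (rule r(2), rule sym, rule s(2), rule ab)
  then have "q (r * r) \<le> q (r * r + s * s)"
    using q_commuting_squares [of r s] r(1) s(1) by (simp add: q_square)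
  moreover have "q a \<le> e / 3 + q (r * r)"
    using q_triangle [of a "r * r"] r(3) q_diff_commute [of a "r * r"] by simp
  moreover have "q (r * r + s * s) \<le> q (a + b) + q (r * r - a) + q (s * s - b)"
    using q_triangle [of "r * r + s * s" "a + b"] q_add [of "r * r - a" "s * s - b"]
    by (simp add: algebra_simps)
  ultimately show "q a \<le> q (a + b) + e"
    using r(3) s(3) by linarith
qed

text \<open>With \<open>t = q (a + b)\<close>, the element \<open>of_real t - a\<close> is the sum
  of \<open>b\<close> and \<open>of_real t - (a + b)\<close>, hence positive. It commutes with
  \<open>a\<close>, so the commuting case applies to this pair, whose sum is a scalar.\<close>

lemma q_le_pos_add:
  assumes a: "pos a" and b: "pos b"
  shows "q a \<le> q (a + b)"
proof -
  define t where "t = q (a + b)"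
  have "pos (of_real t - (a + b))"
    using a b by (intro pos_of_real_diff) (simp_all add: t_def pos_adj)
  then have "pos (of_real t - a)"
    using pos_add [OF b, of "of_real t - (a + b)"] by (simp add: algebra_simps)
  then have "q a \<le> q (a + (of_real t - a))"
    using a by (intro q_le_commuting_pos_add) (simp_all add: algebra_simps of_real_def)
  then show ?thesis
    using q_of_real_le [of t] by (simp add: t_def)
qed

section \<open>Positivity of \<open>adj b * b\<close>\<close>

lemma q_power_two_power: "adj x = x \<Longrightarrow> q (x ^ (2 ^ m)) = q x ^ (2 ^ m)"
proof (induction m)
  case (Suc m)
  have adj_power: "adj (x ^ n) = x ^ n" for n
    by (induction n) (simp_all add: Suc power_commutes)
  have "x ^ (2 ^ Suc m) = x ^ (2 ^ m) * x ^ (2 ^ m)"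
    by (simp add: mult_2 power_add)
  then show ?case
    using Suc adj_power by (simp add: q_square mult.commute flip: power_mult)
qed simp

text \<open>Replaces the equality of the nonzero spectra of \<open>c c\<^sup>*\<close> and \<open>c\<^sup>* c\<close>: the powers of
  \<open>t - c\<^sup>* c\<close> are \<open>t\<^sup>n - c\<^sup>* G\<^sub>n c\<close> with \<open>G\<^sub>n\<close> a polynomial in \<open>c c\<^sup>*\<close>, so their norms
  grow no faster than \<open>n T\<^sup>n\<close>.\<close>

lemma pos_add_mult_adj_swap:
  assumes pos: "pos (of_real \<eta> + c * adj c)" and "0 \<le> \<eta>"
  shows "pos (of_real \<eta> + adj c * c)"
proof -
  \<comment> \<open>The norm term makes \<open>T\<close> a bound for the seminorm of
    \<open>of_real T - (of_real \<eta> + c * adj c)\<close>, which equals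
    \<open>of_real t - c * adj c\<close>; the term \<open>1 + \<eta>\<close> ensures
    \<open>1 \<le> T\<close> and \<open>0 \<le> t\<close>.\<close>
  define T where "T = 1 + \<eta> + q (of_real \<eta> + c * adj c)"
  define t where "t = T - \<eta>"
  have T: "1 \<le> T" "0 \<le> t" "t \<le> T"
    using \<open>0 \<le> \<eta>\<close> by (simp_all add: T_def t_def)
  have tz: "q (of_real t - c * adj c) \<le> T"
    using q_of_real_diff_pos [OF pos, of T] \<open>0 \<le> \<eta>\<close>
    by (simp add: T_def t_def algebra_simps)
  have "\<exists>G. (of_real t - adj c * c) ^ n = of_real (t ^ n) - adj c * G * c \<and> q G \<le> real n * T ^ n"
    for n
  proof (induction n)
    case 0
    then show ?case
      by (intro exI [of _ 0]) simp
  next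
    case (Suc n)
    then obtain G where G: "(of_real t - adj c * c) ^ n = of_real (t ^ n) - adj c * G * c"
      "q G \<le> real n * T ^ n"
      by auto
    \<comment> \<open>The recursion comes from
      \<open>c * (of_real t - adj c * c) = (of_real t - c * adj c) * c\<close>.\<close>
    define G' where "G' = of_real (t ^ n) + G * (of_real t - c * adj c)"
    have "(of_real t - adj c * c) ^ Suc n
        = (of_real (t ^ n) - adj c * G * c) * (of_real t - adj c * c)"
      by (simp only: power_Suc2 G)
    also have "\<dots> = of_real (t ^ Suc n) - adj c * G' * c"
      by (simp add: G'_def algebra_simps of_real_def)
    finally have "(of_real t - adj c * c) ^ Suc n = of_real (t ^ Suc n) - adj c * G' * c" .
    moreover have "q G' \<le> real (Suc n) * T ^ Suc n"
    proof -
      have "q (of_real (t ^ n)) \<le> T ^ Suc n"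
      proof -
        have "t ^ n \<le> T ^ n"
          using T by (intro power_mono) auto
        also have "\<dots> \<le> T ^ Suc n"
          using T by (intro power_increasing) auto
        finally show ?thesis
          using q_of_real_le [of "t ^ n"] T by simp
      qed
      moreover have "q (G * (of_real t - c * adj c)) \<le> real n * T ^ n * T"
        using q_mult [of G "of_real t - c * adj c"] mult_mono [OF G(2) tz] T by simp
      ultimately show ?thesis
        using q_add [of "of_real (t ^ n)" "G * (of_real t - c * adj c)"]
        by (simp add: G'_def algebra_simps)
    qed
    ultimately show ?case
      by blast
  qed
  then have bound: "q ((of_real t - adj c * c) ^ n) \<le> T ^ n * (1 + real n * (q c)\<^sup>2)" for n
  proof -
    obtain G where G: "(of_real t - adj c * c) ^ n = of_real (t ^ n) - adj c * G * c"
      "q G \<le> real n * T ^ n"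
      using \<open>\<And>n. \<exists>G. _ n G\<close> by blast
    have "q (adj c * G * c) \<le> q (adj c * G) * q c"
      by (rule q_mult)
    also have "\<dots> \<le> q c * q G * q c"
      using q_mult [of "adj c" G] by (simp add: mult_right_mono)
    also have "\<dots> \<le> q c * (real n * T ^ n) * q c"
      using G(2) by (intro mult_left_mono mult_right_mono) auto
    finally have "q (adj c * G * c) \<le> T ^ n * (real n * (q c)\<^sup>2)"
      by (simp add: power2_eq_square mult_ac)
    moreover have "q (of_real (t ^ n)) \<le> T ^ n"
      using q_of_real_le [of "t ^ n"] power_mono [of t T n] T by simp
    ultimately show ?thesis
      using q_diff [of "of_real (t ^ n)" "adj c * G * c"] by (simp add: G(1) algebra_simps)
  qed
  have "q (of_real t - adj c * c) ^ (2 ^ m) \<le> T ^ (2 ^ m) * (1 + real (2 ^ m) * (q c)\<^sup>2)" for m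
    using bound [of "2 ^ m"] q_power_two_power [of "of_real t - adj c * c" m] by simp
  then have "q (of_real t - adj c * c) \<le> T"
    by (rule power_le_linear_imp_le [rotated]) (use T in simp)
  moreover have "of_real t - adj c * c = of_real T - (of_real \<eta> + adj c * c)"
    by (simp add: t_def)
  ultimately show ?thesis
    unfolding pos_def using T by (auto intro!: exI [of _ T])
qed

text \<open>Up to a factor, this is the sum of the squares of the real and imaginary parts of
  \<open>c\<close>; \<open>x\<close> and \<open>y\<close> are twice these parts.\<close>

lemma pos_mult_adj_add: "pos (c * adj c + adj c * c)"
proof -
  define x where "x = c + adj c"
  define y where "y = iu * (adj c - c)"
  have x: "adj x = x" and y: "adj y = y"
    by (simp_all add: x_def y_def adj_iu iu_commute algebra_simps)
  have "iu * (adj c - c) * (iu * (adj c - c)) = iu * ((adj c - c) * iu) * (adj c - c)"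
    by (simp only: mult.assoc)
  also have "\<dots> = iu * iu * ((adj c - c) * (adj c - c))"
    by (simp only: iu_commute [of "adj c - c", symmetric] mult.assoc)
  finally have "y * y = - ((adj c - c) * (adj c - c))"
    by (simp add: iu_square y_def)
  then have "x * x + y * y = 2 *\<^sub>R (c * adj c + adj c * c)"
    by (simp add: x_def algebra_simps scaleR_2)
  moreover have "pos (x * x + y * y)"
    using x y by (intro pos_add pos_square)
  ultimately show ?thesis
    using pos_scaleR [of "x * x + y * y" "1/2"] by simp
qed

text \<open>A quantitative form of the fact that \<open>- (adj c * c)\<close> is positive only if
  \<open>q c = 0\<close>. Adding \<open>pos_mult_adj_add\<close> and swapping the factors makes
  \<open>of_real \<eta> + adj c * c\<close> positive; its sum with the element of the hypothesis is
  the scalar \<open>2 * \<eta>\<close>, so monotonicity bounds it.\<close>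

lemma q_le_if_pos_minus_adj_mult:
  assumes "pos (of_real \<eta> - adj c * c)" and "0 \<le> \<eta>"
  shows "q (adj c * c) \<le> 3 * \<eta>"
proof -
  have "(c * adj c + adj c * c) + (of_real \<eta> - adj c * c) = of_real \<eta> + c * adj c"
    by simp
  then have "pos (of_real \<eta> + c * adj c)"
    using pos_add [OF pos_mult_adj_add [of c] assms(1)] by (simp add: add.commute)
  then have "pos (of_real \<eta> + adj c * c)"
    using assms(2) by (rule pos_add_mult_adj_swap)
  then have "q (of_real \<eta> + adj c * c) \<le> q ((of_real \<eta> + adj c * c) + (of_real \<eta> - adj c * c))"
    using assms(1) by (rule q_le_pos_add)
  also have "(of_real \<eta> + adj c * c) + (of_real \<eta> - adj c * c) = of_real (2 * \<eta>)"
    by (metis add.commute add_diff_eq diff_add_cancel mult_2 of_real_add)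
  also have "q (of_real (2 * \<eta>)) \<le> 2 * \<eta>"
    using q_of_real_le [of "2 * \<eta>"] assms(2) by (simp only: abs_of_nonneg)
  finally have "q (of_real \<eta> + adj c * c) \<le> 2 * \<eta>" .
  moreover have "adj c * c = (of_real \<eta> + adj c * c) - of_real \<eta>"
    by simp
  ultimately show ?thesis
    using q_diff [of "of_real \<eta> + adj c * c" "of_real \<eta>"] q_of_real_le [of \<eta>] assms(2)
    by simp
qed

text \<open>An approximate root \<open>s\<close> of \<open>u\<close> commutes with \<open>v\<close>,
  so \<open>v * u * v\<close> is close to the square of the self-adjoint element
  \<open>s * v\<close>.\<close>

lemma pos_mult_commuting_square:
  assumes u: "pos u" and v: "adj v = v" and uv: "v * u = u * v"
  shows "pos (v * u * v)"
proof (rule pos_closed)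
  show "adj (v * u * v) = v * u * v"
    by (simp add: v pos_adj u mult.assoc)
next
  fix e :: real
  assume "0 < e"
  define d where "d = e / ((q v)\<^sup>2 + 1)"
  have "0 < (q v)\<^sup>2 + 1"
    by (simp add: add_nonneg_pos)
  then have d: "0 < d" "d * (q v)\<^sup>2 < e"
    using \<open>0 < e\<close> by (simp_all add: d_def field_simps)
  obtain s where s: "adj s = s" "\<And>y. y * u = u * y \<Longrightarrow> y * s = s * y" "q (s * s - u) < d"
    by (rule pos_approximate_square [OF u d(1)], rule that)
  have sv: "v * s = s * v"
    by (rule s(2), rule uv)
  have "pos (s * v * (s * v))"
    by (rule pos_square) (simp add: s(1) v sv)
  moreover have "q (v * u * v - s * v * (s * v)) < e"
  proof -
    have "s * v * (s * v) = v * (s * s) * v"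
      by (metis sv mult.assoc)
    then have "v * u * v - s * v * (s * v) = v * (u - s * s) * v"
      by (simp add: algebra_simps)
    also have "q \<dots> \<le> q v * q (u - s * s) * q v"
      using q_mult [of "v * (u - s * s)" v] q_mult [of v "u - s * s"]
        mult_right_mono [of "q (v * (u - s * s))" "q v * q (u - s * s)" "q v"] by simp
    also have "\<dots> = q (s * s - u) * (q v)\<^sup>2"
      by (simp add: power2_eq_square q_diff_commute [of u])
    also have "\<dots> \<le> d * (q v)\<^sup>2"
      using s(3) by (intro mult_right_mono) simp_all
    finally show ?thesis
      using d(2) by simp
  qed
  ultimately show "\<exists>b. pos b \<and> q (v * u * v - b) < e"
    by blast
qed

text \<open>Kaplansky's argument, with an approximate square root \<open>u\<close> of \<open>h\<^sup>2\<close> in place of the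
  modulus of \<open>h = b\<^sup>* b\<close>: for \<open>v = u - h\<close>, roughly twice the negative part of \<open>h\<close>, the element
  \<open>(b v)\<^sup>* (b v) = v h v\<close> is approximately \<open>- v u v\<close>, hence approximately negative, which forces it
  to be small.\<close>

lemma pos_adj_mult: "pos (adj b * b)"
proof (rule pos_closed)
  fix e :: real
  assume "0 < e"
  define h where "h = adj b * b"
  have ah: "adj h = h"
    by (simp add: h_def)
  define K where "K = q h + 1"
  have K: "1 \<le> K" "q h \<le> K"
    by (simp_all add: K_def)
  \<comment> \<open>The constants anticipate the final estimate
    \<open>q (v * v * v) \<le> 18 * K * \<delta>\<close>; the 19 leaves room for a strict
    inequality.\<close>
  define \<delta> where "\<delta> = min 1 (e ^ 3 / (19 * K))"
  have \<delta>: "0 < \<delta>" "\<delta> \<le> 1" "18 * K * \<delta> < e ^ 3"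
  proof -
    show "0 < \<delta>" "\<delta> \<le> 1"
      using \<open>0 < e\<close> K by (simp_all add: \<delta>_def)
    have "19 * K * \<delta> \<le> e ^ 3"
      using K by (simp add: \<delta>_def min_def field_simps)
    moreover have "18 * K * \<delta> < 19 * K * \<delta>"
      using K \<open>0 < \<delta>\<close> by simp
    ultimately show "18 * K * \<delta> < e ^ 3"
      by linarith
  qed
  obtain u where u: "adj u = u" "pos u" "\<And>y. y * (h * h) = h * h * y \<Longrightarrow> y * u = u * y"
    "q (u * u - h * h) < \<delta>"
    by (rule pos_approximate_square [OF pos_square [OF ah] \<delta>(1)], rule that)
  have hu: "h * u = u * h"
    by (rule u(3)) (simp add: mult.assoc)
  have "q u \<le> K"
  proof -
    have "(q u)\<^sup>2 \<le> \<delta> + (q h)\<^sup>2"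
      using q_triangle [of "u * u" "h * h"] u(1,4) ah by (simp add: q_square)
    also have "\<dots> \<le> K\<^sup>2"
    proof -
      have "\<delta> \<le> 1 + 2 * q h"
        using \<delta>(2) q_ge_0 [of h] by linarith
      then show ?thesis
        by (simp add: K_def power2_sum)
    qed
    finally show ?thesis
      using K by (simp add: power2_le_iff_abs_le)
  qed
  define v where "v = u - h"
  define d where "d = u * u - h * h"
  have av: "adj v = v"
    by (simp add: v_def u(1) ah)
  have vu: "v * u = u * v"
    by (simp add: v_def algebra_simps hu)
  have "q v \<le> 2 * K"
    using q_diff [of u h] K \<open>q u \<le> K\<close> by (simp add: v_def)
  have qdv: "q (d * v) \<le> 2 * K * \<delta>"
  proof -
    have "q (d * v) \<le> q d * q v"
      by (rule q_mult)
    also have "\<dots> \<le> \<delta> * (2 * K)"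
      using u(4) \<open>q v \<le> 2 * K\<close> \<delta> by (intro mult_mono) (simp_all add: d_def)
    finally show ?thesis
      by (simp add: mult_ac)
  qed
  have dv: "adj (d * v) = d * v"
  proof -
    have "h * (u * x) = u * (h * x)" for x
      by (simp add: hu flip: mult.assoc)
    then have "v * d = d * v"
      by (simp add: d_def v_def algebra_simps hu)
    then show ?thesis
      by (simp add: av) (simp add: d_def u(1) ah)
  qed
  have vh: "v * h * v = d * v - v * u * v"
  proof -
    have "v * h = d - v * u"
      by (simp add: v_def d_def algebra_simps hu)
    then show ?thesis
      by (simp add: left_diff_distrib)
  qed
  define \<eta> where "\<eta> = 2 * K * \<delta>"
  have \<eta>: "0 \<le> \<eta>"
    using K \<delta> by (simp add: \<eta>_def)
  have "adj (b * v) * (b * v) = v * h * v"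
    by (simp add: av h_def mult.assoc)
  moreover have "pos (of_real \<eta> - v * h * v)"
  proof -
    have "of_real \<eta> - v * h * v = v * u * v + (of_real \<eta> - d * v)"
      by (simp add: vh)
    then show ?thesis
      using pos_add [OF pos_mult_commuting_square [OF u(2) av vu] pos_of_real_diff [OF dv qdv]]
      by (simp only: \<eta>_def)
  qed
  ultimately have "q (v * h * v) \<le> 3 * \<eta>"
    using q_le_if_pos_minus_adj_mult [of \<eta> "b * v"] \<eta> by simp
  moreover have "v * v * v = d * v - 2 *\<^sub>R (v * h * v)"
  proof -
    have "v * v = d - 2 *\<^sub>R (v * h)"
      by (simp add: v_def d_def algebra_simps hu scaleR_2)
    then show ?thesis
      by (simp add: left_diff_distrib)
  qed
  ultimately have "q (v * v * v) \<le> 9 * \<eta>"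
    using q_diff [of "d * v" "2 *\<^sub>R (v * h * v)"] qdv \<eta> by (simp add: \<eta>_def)
  then have "q (v * v * v) < e ^ 3"
    using \<delta>(3) by (simp add: \<eta>_def)
  \<comment> \<open>The C*-identity computes the seminorm of the fourth power exactly;
    submultiplicativity splits off one factor \<open>q v\<close>, which is then cancelled.\<close>
  moreover have "(q v) ^ 3 \<le> q (v * v * v)"
  proof -
    have "q v * (q v) ^ 3 = (q (v * v))\<^sup>2"
      by (simp add: q_square av power2_eq_square power3_eq_cube)
    also have "\<dots> = q (v * (v * v * v))"
      using q_square [of "v * v"] av by (simp add: mult.assoc)
    also have "\<dots> \<le> q v * q (v * v * v)"
      by (rule q_mult)
    finally show ?thesis
      using q_ge_0 [of v] by (cases "q v = 0") simp_all
  qed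
  ultimately have "(q v) ^ 3 < e ^ 3"
    by linarith
  then have "q v < e"
    using \<open>0 < e\<close> by (meson less_imp_le power_less_imp_less_base)
  then have "q (h - u) < e"
    by (simp add: v_def q_diff_commute [of u])
  then show "\<exists>a. pos a \<and> q (adj b * b - a) < e"
    using u(2) h_def by blast
qed simp

text \<open>For an approximate root \<open>s\<close> of \<open>c\<close>, the conjugate is close to
  \<open>adj (s * w) * (s * w)\<close>, which \<open>pos_adj_mult\<close> covers.\<close>

lemma pos_conj:
  assumes c: "pos c"
  shows "pos (adj w * c * w)"
proof (rule pos_closed)
  show "adj (adj w * c * w) = adj w * c * w"
    by (simp add: pos_adj c mult.assoc)
next
  fix e :: real
  assume "0 < e"
  define d where "d = e / ((q w)\<^sup>2 + 1)"
  have "0 < (q w)\<^sup>2 + 1"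
    by (simp add: add_nonneg_pos)
  then have d: "0 < d" "d * (q w)\<^sup>2 < e"
    using \<open>0 < e\<close> by (simp_all add: d_def field_simps)
  obtain s where s: "adj s = s" "q (s * s - c) < d"
    by (rule pos_approximate_square [OF c d(1)], rule that)
  have "q (adj w * c * w - adj w * (s * s) * w) = q (adj w * (s * s - c) * w)"
    by (subst q_diff_commute) (simp add: algebra_simps)
  also have "\<dots> \<le> q w * q (s * s - c) * q w"
    using q_mult [of "adj w * (s * s - c)" w] q_mult [of "adj w" "s * s - c"]
      mult_right_mono [of "q (adj w * (s * s - c))" "q w * q (s * s - c)" "q w"] by simp
  also have "\<dots> \<le> d * (q w)\<^sup>2"
    using mult_right_mono [of "q (s * s - c)" d "(q w)\<^sup>2"] s(2)
    by (simp add: power2_eq_square mult_ac)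
  finally have "q (adj w * c * w - adj w * (s * s) * w) < e"
    using d(2) by simp
  moreover have "pos (adj w * (s * s) * w)"
    using pos_adj_mult [of "s * w"] by (simp add: s(1) mult.assoc)
  ultimately show "\<exists>b. pos b \<and> q (adj w * c * w - b) < e"
    by blast
qed

end

section \<open>Adjoining a unit\<close>

interpretation scaleC: vector_space "scaleC :: complex \<Rightarrow> 'a::complex_vector \<Rightarrow> 'a"
  by unfold_locales (fact scaleC_add_right scaleC_add_left scaleC_scaleC scaleC_one)+

lemma star_zero [simp]: "star (0 :: 'a::complex_star_algebra) = 0"
  using star_scaleC [of 0 "0 :: 'a"] by simp

lemma star_minus: "star (- x) = - star (x :: 'a::complex_star_algebra)"
  using star_scaleC [of "-1" x] by simp

lemma star_diff: "star (x - y) = star x - star (y :: 'a::complex_star_algebra)"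
  using star_add [of x "- y"] by (simp add: star_minus)

text \<open>\<open>Unitization c a\<close> stands for the formal sum \<open>c + a\<close>.\<close>

datatype 'a unitization = Unitization (scalar_part: complex) (vector_part: 'a)

instantiation unitization :: (complex_algebra) real_algebra_1
begin

definition "0 = Unitization 0 0"
definition "1 = Unitization 1 0"
definition "x + y = Unitization (scalar_part x + scalar_part y) (vector_part x + vector_part y)"
definition "x - y = Unitization (scalar_part x - scalar_part y) (vector_part x - vector_part y)"
definition "- x = Unitization (- scalar_part x) (- vector_part x)"
definition "r *\<^sub>R x = Unitization (r *\<^sub>R scalar_part x) (complex_of_real r *\<^sub>C vector_part x)"
definition "x * y = Unitization (scalar_part x * scalar_part y)
  (scalar_part x *\<^sub>C vector_part y + scalar_part y *\<^sub>C vector_part x + vector_part x * vector_part y)"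

lemmas unitization_simps =
  zero_unitization_def one_unitization_def plus_unitization_def minus_unitization_def
  uminus_unitization_def scaleR_unitization_def times_unitization_def

instance
  by standard
     (simp_all add: unitization_simps algebra_simps scaleC.scale_right_distrib
       scaleC.scale_left_distrib mult_scaleC_left mult_scaleC_right scaleR_conv_of_real)

end

lemma of_real_unitization:
  "(of_real r :: 'a::complex_algebra unitization) = Unitization (of_real r) 0"
  by (simp add: of_real_def unitization_simps)

definition unitization_adj :: "'a::complex_star_algebra unitization \<Rightarrow> 'a unitization"
  where "unitization_adj z = Unitization (cnj (scalar_part z)) (star (vector_part z))"

definition unitization_act :: "'a::complex_algebra unitization \<Rightarrow> 'a \<Rightarrow> 'a"
  where "unitization_act z x = scalar_part z *\<^sub>C x + vector_part z * x"

text \<open>The operator seminorm of left multiplication on the original algebra. It inherits the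
  C*-identity, which the sum of the two component norms in general violates.\<close>

definition unitization_seminorm ::
    "('a::complex_algebra \<Rightarrow> real) \<Rightarrow> 'a unitization \<Rightarrow> real"
  where "unitization_seminorm p z = (SUP x\<in>{x. p x \<le> 1}. p (unitization_act z x))"

section \<open>The operator seminorm on the unitization is a C*-seminorm\<close>

locale cstar_seminormed_star_algebra =
  fixes p :: "'a::complex_star_algebra \<Rightarrow> real"
  assumes cstar_seminorm: "cstar_seminorm p"
begin

lemma p_ge_0 [simp]: "0 \<le> p x"
  and p_add: "p (x + y) \<le> p x + p y"
  and p_scaleC [simp]: "p (c *\<^sub>C x) = cmod c * p x"
  and p_mult: "p (x * y) \<le> p x * p y"
  and p_star [simp]: "p (star x) = p x"
  and p_cstar: "p (star x * x) = (p x)\<^sup>2"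
  using cstar_seminorm by (auto simp: cstar_seminorm_def seminorm_def)

lemma p_zero [simp]: "p 0 = 0"
  using p_scaleC [of 0 0] by simp

abbreviation (input) q :: "'a unitization \<Rightarrow> real"
  where "q \<equiv> unitization_seminorm p"

lemma p_act_le: "p (unitization_act z x) \<le> (cmod (scalar_part z) + p (vector_part z)) * p x"
  using p_add [of "scalar_part z *\<^sub>C x" "vector_part z * x"] p_mult [of "vector_part z" x]
  by (simp add: unitization_act_def algebra_simps)

lemma p_act_le_q_unit:
  assumes "p x \<le> 1"
  shows "p (unitization_act z x) \<le> q z"
  unfolding unitization_seminorm_def
proof (rule cSUP_upper)
  show "bdd_above ((\<lambda>x. p (unitization_act z x)) ` {x. p x \<le> 1})"
  proof (rule bdd_aboveI2)
    fix x
    assume "x \<in> {x. p x \<le> 1}"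
    then show "p (unitization_act z x) \<le> (cmod (scalar_part z) + p (vector_part z)) * 1"
      by (intro order_trans [OF p_act_le] mult_left_mono) simp_all
  qed
qed (use assms in simp)

lemma q_ge_0 [simp]: "0 \<le> q z"
  by (rule order_trans [OF p_ge_0 p_act_le_q_unit [of 0]]) simp

lemma q_leI:
  assumes "\<And>x. p x \<le> 1 \<Longrightarrow> p (unitization_act z x) \<le> C"
  shows "q z \<le> C"
  unfolding unitization_seminorm_def
  by (rule cSUP_least) (use assms in \<open>auto intro!: exI [of _ 0]\<close>)

lemma unitization_act_scaleC: "unitization_act z (c *\<^sub>C x) = c *\<^sub>C unitization_act z x"
  by (simp add: unitization_act_def scaleC.scale_right_distrib mult_scaleC_right mult.commute)

lemma p_act_le_q: "p (unitization_act z x) \<le> q z * p x"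
proof (cases "p x = 0")
  case True
  then show ?thesis
    using p_act_le [of z x] by simp
next
  case False
  then have px: "0 < p x"
    using p_ge_0 [of x] by linarith
  have "p (unitization_act z (complex_of_real (1 / p x) *\<^sub>C x)) \<le> q z"
    using px by (intro p_act_le_q_unit) (simp add: norm_divide)
  then show ?thesis
    using px by (simp add: unitization_act_scaleC norm_divide field_simps)
qed

lemma unitization_act_add: "unitization_act (z + w) x = unitization_act z x + unitization_act w x"
  by (simp add: unitization_act_def unitization_simps algebra_simps scaleC.scale_left_distrib)

lemma unitization_act_mult: "unitization_act (z * w) x = unitization_act z (unitization_act w x)"
  by (simp add: unitization_act_def unitization_simps algebra_simps scaleC.scale_right_distrib
      scaleC.scale_left_distrib mult_scaleC_left mult_scaleC_right)

lemma star_unitization_act_mult: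
  "star (unitization_act z x) * y = star x * unitization_act (unitization_adj z) y"
  by (simp add: unitization_act_def unitization_adj_def star_add star_mult star_scaleC algebra_simps
      mult_scaleC_left mult_scaleC_right)

text \<open>For \<open>p x \<le> 1\<close>, the C*-identity of \<open>p\<close> and the adjoint rule
  turn \<open>(p (unitization_act z x))\<^sup>2\<close> into
  \<open>p (star x * unitization_act (unitization_adj z * z) x)\<close>.\<close>

lemma q_square_le: "(q z)\<^sup>2 \<le> q (unitization_adj z * z)"
proof -
  have "q z \<le> sqrt (q (unitization_adj z * z))"
  proof (rule q_leI)
    fix x
    assume x: "p x \<le> 1"
    have "(p (unitization_act z x))\<^sup>2 = p (star x * unitization_act (unitization_adj z * z) x)"
      by (simp add: p_cstar [symmetric] star_unitization_act_mult unitization_act_mult)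
    also have "\<dots> \<le> p x * p (unitization_act (unitization_adj z * z) x)"
      using p_mult [of "star x"] by simp
    also have "\<dots> \<le> 1 * q (unitization_adj z * z)"
      using x by (intro mult_mono p_act_le_q_unit) simp_all
    finally show "p (unitization_act z x) \<le> sqrt (q (unitization_adj z * z))"
      by (simp add: real_le_rsqrt)
  qed
  then have "(q z)\<^sup>2 \<le> (sqrt (q (unitization_adj z * z)))\<^sup>2"
    by (intro power_mono) simp_all
  then show ?thesis
    by simp
qed

lemma q_mult: "q (z * w) \<le> q z * q w"
proof (rule q_leI)
  fix x
  assume "p x \<le> 1"
  then have "p (unitization_act w x) \<le> q w"
    by (rule p_act_le_q_unit)
  then have "q z * p (unitization_act w x) \<le> q z * q w"
    by (rule mult_left_mono) simp
  then show "p (unitization_act (z * w) x) \<le> q z * q w"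
    unfolding unitization_act_mult using p_act_le_q order_trans by blast
qed

lemma q_adj: "q (unitization_adj z) = q z"
proof -
  have *: "q z \<le> q (unitization_adj z)" for z
  proof (cases "q z = 0")
    case False
    then have "0 < q z"
      using q_ge_0 [of z] by linarith
    moreover have "q z * q z \<le> q (unitization_adj z) * q z"
      using q_square_le [of z] q_mult [of "unitization_adj z" z] by (simp add: power2_eq_square)
    ultimately show ?thesis
      by simp
  qed simp
  have "unitization_adj (unitization_adj z) = z"
    by (simp add: unitization_adj_def star_star)
  then show ?thesis
    using * [of z] * [of "unitization_adj z"] by simp
qed

lemma q_scaleR: "q (r *\<^sub>R z) = \<bar>r\<bar> * q z"
proof -
  have act: "unitization_act (r *\<^sub>R z) x = complex_of_real r *\<^sub>C unitization_act z x" for r z x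
    by (simp add: unitization_act_def unitization_simps scaleC.scale_right_distrib mult_scaleC_left
        scaleR_conv_of_real)
  have le: "q (r *\<^sub>R z) \<le> \<bar>r\<bar> * q z" for r z
    by (rule q_leI) (simp add: act mult_left_mono p_act_le_q_unit)
  show ?thesis
  proof (cases "r = 0")
    case True
    then show ?thesis
      using le [of 0 z] q_ge_0 [of "0 *\<^sub>R z"] by (metis abs_zero antisym mult_zero_left)
  next
    case False
    then have "\<bar>r\<bar> * q z \<le> \<bar>r\<bar> * (\<bar>1 / r\<bar> * q (r *\<^sub>R z))"
      using le [of "1 / r" "r *\<^sub>R z"] by (intro mult_left_mono) simp_all
    then have "\<bar>r\<bar> * q z \<le> q (r *\<^sub>R z)"
      using False by (simp add: abs_divide)
    then show ?thesis
      using le [of r z] by simp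
  qed
qed

text \<open>So \<open>q\<close> extends \<open>p\<close>: the lower bound comes from testing left
  multiplication by \<open>a\<close> on \<open>star a\<close>.\<close>

lemma q_vector: "q (Unitization 0 a) = p a"
proof (rule antisym)
  show "q (Unitization 0 a) \<le> p a"
  proof (rule q_leI)
    fix x
    assume "p x \<le> 1"
    then show "p (unitization_act (Unitization 0 a) x) \<le> p a"
      using p_mult [of a x] mult_left_mono [of "p x" 1 "p a"] by (simp add: unitization_act_def)
  qed
  show "p a \<le> q (Unitization 0 a)"
  proof (cases "p a = 0")
    case False
    then have "0 < p a"
      using p_ge_0 [of a] by linarith
    moreover have "p a * p a \<le> q (Unitization 0 a) * p a"
      using p_act_le_q [of "Unitization 0 a" "star a"] p_cstar [of "star a"]
      by (simp add: unitization_act_def star_star power2_eq_square)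
    ultimately show ?thesis
      by simp
  qed simp
qed

sublocale unitization: unital_cstar_seminormed_algebra unitization_adj q "Unitization \<i> 0"
proof
  fix x y :: "'a unitization" and r :: real
  show "unitization_adj (unitization_adj x) = x"
    by (simp add: unitization_adj_def star_star)
  show "unitization_adj (x + y) = unitization_adj x + unitization_adj y"
    by (simp add: unitization_adj_def unitization_simps star_add)
  show "unitization_adj (r *\<^sub>R x) = r *\<^sub>R unitization_adj x"
    by (simp add: unitization_adj_def unitization_simps star_scaleC)
  show "unitization_adj (x * y) = unitization_adj y * unitization_adj x"
    by (simp add: unitization_adj_def unitization_simps star_scaleC star_add star_mult algebra_simps)
  show "Unitization \<i> 0 * Unitization \<i> 0 = (- 1 :: 'a unitization)"
    "Unitization \<i> 0 * x = x * Unitization \<i> 0"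
    "unitization_adj (Unitization \<i> 0) = - (Unitization \<i> 0 :: 'a unitization)"
    by (simp_all add: unitization_adj_def unitization_simps)
  show "q (x + y) \<le> q x + q y"
  proof (rule q_leI)
    fix v
    assume "p v \<le> 1"
    then show "p (unitization_act (x + y) v) \<le> q x + q y"
      unfolding unitization_act_add
      using p_add [of "unitization_act x v" "unitization_act y v"]
        p_act_le_q_unit [of v x] p_act_le_q_unit [of v y] by linarith
  qed
  show "q (unitization_adj x * x) = (q x)\<^sup>2"
    using q_square_le [of x] q_mult [of "unitization_adj x" x]
    by (simp add: q_adj power2_eq_square)
qed (fact q_scaleR q_mult q_adj)+

text \<open>The cone depends on \<open>p\<close>. It contains every \<open>positive\<close> element
  and inherits closure under sums and self-adjoint \<open>p\<close>-limits from
  \<open>pos\<close>.\<close>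

definition cone :: "'a \<Rightarrow> bool"
  where "cone a \<longleftrightarrow> unitization.pos (Unitization 0 a)"

lemma cone_star: "cone a \<Longrightarrow> star a = a"
  unfolding cone_def using unitization.pos_adj by (fastforce simp: unitization_adj_def)

lemma cone_star_mult: "cone (star b * b)"
  using unitization.pos_adj_mult [of "Unitization 0 b"]
  by (simp add: cone_def unitization_adj_def unitization_simps)

lemma cone_zero: "cone 0"
  using cone_star_mult [of 0] by simp

lemma cone_add: "cone a \<Longrightarrow> cone b \<Longrightarrow> cone (a + b)"
  unfolding cone_def using unitization.pos_add by (fastforce simp: unitization_simps)

lemma cone_sum: "(\<And>i. i \<in> I \<Longrightarrow> cone (f i)) \<Longrightarrow> cone (sum f I)"
  by (induction I rule: infinite_finite_induct) (simp_all add: cone_zero cone_add)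

lemma cone_scaleC: "cone a \<Longrightarrow> 0 \<le> r \<Longrightarrow> cone (complex_of_real r *\<^sub>C a)"
  unfolding cone_def using unitization.pos_scaleR [of "Unitization 0 a" r]
  by (simp add: unitization_simps)

lemma p_le_cone_add: "cone a \<Longrightarrow> cone b \<Longrightarrow> p a \<le> p (a + b)"
  unfolding cone_def
  using unitization.q_le_pos_add [of "Unitization 0 a" "Unitization 0 b"]
  by (simp add: unitization_simps q_vector)

lemma cone_closed:
  assumes "star a = a" and approx: "\<And>e. 0 < e \<Longrightarrow> \<exists>b. cone b \<and> p (a - b) < e"
  shows "cone a"
  unfolding cone_def
proof (rule unitization.pos_closed)
  fix e :: real
  assume "0 < e"
  then obtain b where "cone b" "p (a - b) < e"
    using approx by blast
  then show "\<exists>b. unitization.pos b \<and> q (Unitization 0 a - b) < e"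
    by (intro exI [of _ "Unitization 0 b"]) (simp add: cone_def unitization_simps q_vector)
qed (simp add: unitization_adj_def assms(1))

text \<open>Conjugating the positive element \<open>of_real s - Unitization 0 c\<close> by
  \<open>Unitization 0 w\<close> leaves scalar part 0, so the result lies in the algebra
  itself.\<close>

lemma cone_conj_le:
  assumes c: "cone c" "p c \<le> s"
  shows "cone (complex_of_real s *\<^sub>C (star w * w) - star w * c * w)"
proof -
  have "unitization.pos (of_real s - Unitization 0 c)"
    using c by (intro unitization.pos_of_real_diff)
      (simp_all add: q_vector unitization_adj_def cone_star)
  then have "unitization.pos (unitization_adj (Unitization 0 w) * (of_real s - Unitization 0 c)
      * Unitization 0 w)"
    by (rule unitization.pos_conj)
  then show ?thesis
    by (simp add: cone_def of_real_unitization unitization_adj_def unitization_simps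
        algebra_simps mult_scaleC_left)
qed

text \<open>Stated for a semi-inner product \<open>f\<close> relative to a single \<open>p\<close>,
  since it is applied both to \<open>inn\<close> and to the defect forms of partial sums. The bound
  comes from expanding \<open>f z z\<close> at \<open>z = act x \<alpha> - y\<close>.\<close>

lemma cauchy_schwarz:
  fixes act :: "'e::complex_vector \<Rightarrow> 'a \<Rightarrow> 'e" and f :: "'e \<Rightarrow> 'e \<Rightarrow> 'a"
  assumes add: "\<And>x y z. f x (y + z) = f x y + f x z"
    and scaleC: "\<And>x c y. f x (c *\<^sub>C y) = c *\<^sub>C f x y"
    and act: "\<And>x y a. f x (act y a) = f x y * a"
    and star: "\<And>x y. star (f x y) = f y x"
    and cone: "\<And>x. cone (f x x)"
  shows "(p (f x y))\<^sup>2 \<le> p (f x x) * p (f y y)"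
proof -
  have diff: "f x (y - z) = f x y - f x z" for x y z
    using add [of x y "(-1) *\<^sub>C z"] by (simp only: scaleC) simp
  have diff': "f (x - y) z = f x z - f y z" for x y z
    by (metis diff star star_diff)
  define w where "w = f x y"
  \<comment> \<open>A number \<open>s > 0\<close> above \<open>p (f x x)\<close> permits division
    even if \<open>p (f x x) = 0\<close>; \<open>s\<close> is made to approach
    \<open>p (f x x)\<close> at the end.\<close>
  have bound: "(p w)\<^sup>2 \<le> s * p (f y y)" if s: "p (f x x) \<le> s" "0 < s" for s
  proof -
    define t where "t = complex_of_real (1 / s)"
    define \<alpha> where "\<alpha> = t *\<^sub>C w"
    have star_t: "star (t *\<^sub>C a) = t *\<^sub>C star a" for a :: 'a
      by (simp add: t_def star_scaleC)
    have act': "f (act x a) z = star a * f x z" for a z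
      by (metis act star star_mult)
    define z where "z = act x \<alpha> - y"
    have fzz: "f z z = t *\<^sub>C (t *\<^sub>C (star w * f x x * w)) - t *\<^sub>C (star w * w)
        - t *\<^sub>C (star w * w) + f y y"
      by (simp add: z_def diff diff' act act' star_t \<alpha>_def mult_scaleC_left mult_scaleC_right
          w_def star mult.assoc left_diff_distrib scaleC.scale_right_diff_distrib)
    \<comment> \<open>In the cone by \<open>cone_conj_le\<close>; adding
      \<open>t *\<^sub>C (t *\<^sub>C g)\<close> turns the quadratic term of \<open>f z z\<close>
      into \<open>t *\<^sub>C (star w * w)\<close>, which cancels one of the two mixed
      terms.\<close>
    define g where "g = complex_of_real s *\<^sub>C (star w * w) - star w * f x x * w"
    have ts: "t * of_real s = 1"
      using s by (simp add: t_def)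
    have "f y y = t *\<^sub>C (star w * w) + (f z z + t *\<^sub>C (t *\<^sub>C g))"
      by (simp add: fzz g_def scaleC.scale_right_diff_distrib ts)
    moreover have "cone (t *\<^sub>C (t *\<^sub>C g))"
      unfolding t_def g_def using s cone by (intro cone_scaleC cone_conj_le) simp_all
    moreover have "cone (t *\<^sub>C (star w * w))"
      unfolding t_def using s by (intro cone_scaleC cone_star_mult) simp_all
    ultimately have "p (t *\<^sub>C (star w * w)) \<le> p (f y y)"
      using cone by (metis cone_add p_le_cone_add)
    then show ?thesis
      using s by (simp add: t_def p_cstar norm_divide field_simps)
  qed
  have "(p w)\<^sup>2 \<le> p (f x x) * p (f y y)"
  proof (rule field_le_epsilon)
    fix e :: real
    assume "0 < e"
    define d where "d = e / (p (f y y) + 1)"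
    have "0 < p (f y y) + 1"
      by (simp add: add_nonneg_pos)
    then have d: "0 < d" "d * p (f y y) \<le> e"
      using \<open>0 < e\<close> by (simp_all add: d_def field_simps)
    have "(p w)\<^sup>2 \<le> (p (f x x) + d) * p (f y y)"
      using d by (intro bound) (simp_all add: add_nonneg_pos)
    then show "(p w)\<^sup>2 \<le> p (f x x) * p (f y y) + e"
      using d by (simp add: algebra_simps)
  qed
  then show ?thesis
    by (simp add: w_def)
qed

end

section \<open>Hilbert modules and frames of multipliers\<close>

lemma tendsto_seminorm_uniformity_iff:
  fixes f :: "'x \<Rightarrow> 'e::{ab_group_add, uniform_space}"
  assumes P: "uniformity = seminorm_uniformity P" and nonneg: "\<forall>p\<in>P. \<forall>x. 0 \<le> p x"
  shows "(f \<longlongrightarrow> l) F \<longleftrightarrow> (\<forall>p\<in>P. ((\<lambda>n. p (f n - l)) \<longlongrightarrow> 0) F)"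
proof -
  have "(f \<longlongrightarrow> l) F \<longleftrightarrow> filterlim (\<lambda>n. (f n, l)) uniformity F"
    unfolding tendsto_iff_uniformity by (simp add: filterlim_iff)
  also have "\<dots> \<longleftrightarrow> (\<forall>p\<in>P. \<forall>e>0. \<forall>\<^sub>F n in F. p (f n - l) < e)"
    by (simp add: P seminorm_uniformity_def filterlim_INF filterlim_principal Ball_def)
  also have "\<dots> \<longleftrightarrow> (\<forall>p\<in>P. ((\<lambda>n. p (f n - l)) \<longlongrightarrow> 0) F)"
    using nonneg by (simp add: tendsto_iff)
  finally show ?thesis .
qed

text \<open>The class provides only some defining family \<open>P\<close>. Its members are
  continuous, and conversely convergence along \<open>P\<close> forces convergence along each
  continuous C*-seminorm by continuity at 0.\<close>

lemma tendsto_pro_cstar_iff: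
  fixes f :: "'x \<Rightarrow> 'a::pro_cstar_algebra"
  shows "(f \<longlongrightarrow> l) F \<longleftrightarrow>
    (\<forall>p\<in>continuous_cstar_seminorms. ((\<lambda>n. p (f n - l)) \<longlongrightarrow> 0) F)"
proof -
  obtain P :: "('a \<Rightarrow> real) set" where P: "\<And>p. p \<in> P \<Longrightarrow> cstar_seminorm p"
    and unif: "uniformity = seminorm_uniformity P"
    using uniformity_cstar_seminorms by blast
  have nonneg: "\<forall>p\<in>P. \<forall>x. 0 \<le> p x"
    using P by (simp add: cstar_seminorm_def seminorm_def)
  note P_iff = tendsto_seminorm_uniformity_iff [OF unif nonneg]
  have "P \<subseteq> continuous_cstar_seminorms"
  proof
    fix p
    assume "p \<in> P"
    then interpret cstar_seminormed_star_algebra p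
      by unfold_locales (rule P)
    have "(p \<longlongrightarrow> p x) (at x)" for x
    proof -
      have "((\<lambda>y. p (y - x)) \<longlongrightarrow> 0) (at x)"
        using P_iff [of "\<lambda>y. y" x "at x"] \<open>p \<in> P\<close> by simp
      moreover have "\<bar>p y - p x\<bar> \<le> p (y - x)" for y
        using p_add [of "y - x" x] p_add [of "x - y" y] p_scaleC [of "-1" "x - y"] by simp
      ultimately have "((\<lambda>y. p y - p x) \<longlongrightarrow> 0) (at x)"
        by (intro Lim_null_comparison [of "\<lambda>y. p y - p x"]) auto
      then show ?thesis
        by (simp add: LIM_zero_iff)
    qed
    then show "p \<in> continuous_cstar_seminorms"
      by (simp add: continuous_cstar_seminorms_def cstar_seminorm continuous_on_def)
  qed
  moreover have "((\<lambda>n. p (f n - l)) \<longlongrightarrow> 0) F"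
    if lim: "(f \<longlongrightarrow> l) F" and p: "p \<in> continuous_cstar_seminorms" for p
  proof -
    interpret cstar_seminormed_star_algebra p
      using p by unfold_locales (simp add: continuous_cstar_seminorms_def)
    have "((\<lambda>n. f n - l) \<longlongrightarrow> 0) F"
      using lim by (simp add: P_iff)
    moreover have "isCont p 0"
      using p by (simp add: continuous_cstar_seminorms_def continuous_on_eq_continuous_at)
    ultimately show ?thesis
      using isCont_tendsto_compose [of 0 p "\<lambda>n. f n - l" F] by simp
  qed
  ultimately show ?thesis
    using P_iff by blast
qed

text \<open>By the Hausdorff property: the constant sequence \<open>a\<close> converges to
  0.\<close>

lemma pro_cstar_eq_0I:
  fixes a :: "'a::pro_cstar_algebra"
  assumes "\<And>p. p \<in> continuous_cstar_seminorms \<Longrightarrow> p a = 0"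
  shows "a = 0"
proof -
  have "(\<lambda>n. a) \<longlonglongrightarrow> 0"
    unfolding tendsto_pro_cstar_iff
  proof
    fix p :: "'a \<Rightarrow> real"
    assume "p \<in> continuous_cstar_seminorms"
    then have "p a = 0"
      by (rule assms)
    then show "(\<lambda>n. p (a - 0)) \<longlonglongrightarrow> 0"
      by simp
  qed
  then show ?thesis
    by (simp add: LIMSEQ_const_iff)
qed

lemma cstar_seminormed_star_algebra_if_continuous:
  "p \<in> continuous_cstar_seminorms \<Longrightarrow> cstar_seminormed_star_algebra p"
  by unfold_locales (simp add: continuous_cstar_seminorms_def)

section \<open>Inner products of multipliers with module elements\<close>

context pre_hilbert_module
begin

lemma inn_diff_right: "inn x (y - z) = inn x y - inn x z"
  using inn_add_right [of x "y - z" z] by (simp add: algebra_simps)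

lemma inn_add_left: "inn (x + y) z = inn x z + inn y z"
  by (metis inn_add_right star_add star_inn)

lemma inn_diff_left: "inn (x - y) z = inn x z - inn y z"
  by (metis inn_diff_right star_diff star_inn)

lemma inn_zero_left: "inn 0 z = 0"
  using inn_diff_left [of 0 0 z] by simp

lemma inn_sum_left: "inn (sum f I) z = (\<Sum>i\<in>I. inn (f i) z)"
  by (induction I rule: infinite_finite_induct) (simp_all add: inn_add_left inn_zero_left)

text \<open>Justifies the definite description in \<open>adjoint\<close>. The difference of two
  adjoints at \<open>y\<close> is annihilated from the left by every \<open>star x\<close>; with
  \<open>x\<close> equal to this difference, the C*-identity makes all its seminorms vanish.\<close>

lemma is_adjoint_multiplier_inn:
  assumes "h \<in> multiplier_module act inn"
  shows "is_adjoint (*) alg_inn act inn h (multiplier_inn act inn h)"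
proof -
  obtain S where S: "is_adjoint (*) alg_inn act inn h S"
    using assms by (auto simp: multiplier_module_def adjointable_ops_def)
  have unique: "R = S" if R: "is_adjoint (*) alg_inn act inn h R" for R
  proof
    fix y
    have "star x * (R y - S y) = 0" for x
      using R S by (simp add: is_adjoint_def alg_inn_def right_diff_distrib)
    then have eq: "star (R y - S y) * (R y - S y) = 0" .
    have "R y - S y = 0"
    proof (rule pro_cstar_eq_0I)
      fix p :: "'a \<Rightarrow> real"
      assume "p \<in> continuous_cstar_seminorms"
      then interpret cstar_seminormed_star_algebra p
        by (rule cstar_seminormed_star_algebra_if_continuous)
      show "p (R y - S y) = 0"
        using p_cstar [of "R y - S y"] eq by simp
    qed
    then show "R y = S y"
      by simp
  qed
  have "is_adjoint (*) alg_inn act inn h (adjoint (*) alg_inn act inn h)"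
    unfolding adjoint_def
    by (rule theI [where P = "is_adjoint (*) alg_inn act inn h", OF S unique])
  then show ?thesis
    by (simp add: multiplier_inn_def [abs_def])
qed

lemma inn_multiplier:
  "h \<in> multiplier_module act inn \<Longrightarrow> inn (h a) y = star a * multiplier_inn act inn h y"
  using is_adjoint_multiplier_inn by (simp add: is_adjoint_def alg_inn_def)

lemma
  assumes "h \<in> multiplier_module act inn"
  shows multiplier_inn_add:
      "multiplier_inn act inn h (x + y) = multiplier_inn act inn h x + multiplier_inn act inn h y"
    and multiplier_inn_scaleC:
      "multiplier_inn act inn h (c *\<^sub>C x) = c *\<^sub>C multiplier_inn act inn h x"
    and multiplier_inn_act:
      "multiplier_inn act inn h (act x a) = multiplier_inn act inn h x * a"
  using is_adjoint_multiplier_inn [OF assms] by (simp_all add: is_adjoint_def module_morphism_def)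

end

context hilbert_module
begin

lemma tendsto_hilbert_module_iff:
  "(f \<longlongrightarrow> l) F \<longleftrightarrow>
    (\<forall>p\<in>continuous_cstar_seminorms. ((\<lambda>n. p (inn (f n - l) (f n - l))) \<longlongrightarrow> 0) F)"
proof -
  have nonneg: "0 \<le> p a" if "p \<in> continuous_cstar_seminorms" for p :: "'a \<Rightarrow> real" and a
    using that by (simp add: continuous_cstar_seminorms_def cstar_seminorm_def seminorm_def)
  have sqrt_iff: "((\<lambda>n. sqrt (g n)) \<longlongrightarrow> 0) F \<longleftrightarrow> (g \<longlongrightarrow> 0) F"
    if "\<And>n. 0 \<le> g n" for g :: "_ \<Rightarrow> real"
    using tendsto_power [of "\<lambda>n. sqrt (g n)" 0 F 2] tendsto_real_sqrt [of g 0 F] that by auto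
  have "(f \<longlongrightarrow> l) F \<longleftrightarrow> (\<forall>p\<in>inner_seminorm inn ` continuous_cstar_seminorms.
      ((\<lambda>n. p (f n - l)) \<longlongrightarrow> 0) F)"
    by (rule tendsto_seminorm_uniformity_iff [OF uniformity_inner_seminorms])
       (auto simp: inner_seminorm_def nonneg)
  then show ?thesis
    by (simp add: inner_seminorm_def sqrt_iff nonneg)
qed

end

section \<open>The two implications for normalised frames\<close>

context
  fixes act :: "'e::{complex_vector, uniform_space} \<Rightarrow> 'a::pro_cstar_algebra \<Rightarrow> 'e"
    and inn :: "'e \<Rightarrow> 'e \<Rightarrow> 'a"
    and h :: "nat \<Rightarrow> 'a \<Rightarrow> 'e"
  assumes hilbert: "hilbert_module act inn"
    and h: "\<And>n. h n \<in> multiplier_module act inn"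
begin

interpretation hilbert_module act inn
  by (rule hilbert)

abbreviation (input) coeff :: "nat \<Rightarrow> 'e \<Rightarrow> 'a"
  where "coeff n \<equiv> multiplier_inn act inn (h n)"

lemma inn_partial_sum:
  "inn (\<Sum>n<N. h n (coeff n x)) y = (\<Sum>n<N. star (coeff n x) * coeff n y)"
  by (simp add: inn_sum_left inn_multiplier h)

lemma normalised_frame_if_reconstruction:
  assumes "\<And>x. (\<lambda>n. h n (coeff n x)) sums x"
  shows "frame_with_bounds act inn 1 1 h"
proof -
  have sums: "(\<lambda>n. star (coeff n x) * coeff n x) sums inn x x" for x
    unfolding sums_def tendsto_pro_cstar_iff
  proof
    fix p :: "'a \<Rightarrow> real"
    assume p: "p \<in> continuous_cstar_seminorms"
    then interpret cstar_seminormed_star_algebra p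
      by (rule cstar_seminormed_star_algebra_if_continuous)
    define d where "d N = (\<Sum>n<N. h n (coeff n x)) - x" for N
    have "(\<lambda>N. p (inn (d N) (d N))) \<longlonglongrightarrow> 0"
      using assms [of x] p unfolding sums_def tendsto_hilbert_module_iff d_def by blast
    then have "(\<lambda>N. sqrt (p (inn (d N) (d N)) * p (inn x x))) \<longlonglongrightarrow> sqrt (0 * p (inn x x))"
      by (intro tendsto_intros)
    moreover have "p (inn (d N) x) \<le> sqrt (p (inn (d N) (d N)) * p (inn x x))" for N
    proof (rule real_le_rsqrt, rule cauchy_schwarz)
      show "cone (inn y y)" for y
        using inn_positive [of y] cone_star_mult by (auto simp: positive_def)
    qed (rule inn_add_right inn_scaleC_right inn_act_right star_inn)+
    ultimately have "(\<lambda>N. p (inn (d N) x)) \<longlonglongrightarrow> 0"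
      by (intro Lim_null_comparison [of "\<lambda>N. p (inn (d N) x)"]) auto
    then show "(\<lambda>N. p ((\<Sum>n<N. star (coeff n x) * coeff n x) - inn x x)) \<longlonglongrightarrow> 0"
      by (simp add: d_def inn_diff_left inn_partial_sum)
  qed
  \<comment> \<open>The series sums exactly to \<open>inn x x\<close>, so both frame inequalities
    say that 0 is positive.\<close>
  have "positive (0 :: 'a)"
    by (auto simp: positive_def intro!: exI [of _ 0])
  then show ?thesis
    using sums_summable [OF sums] sums_unique [OF sums, symmetric]
    by (simp add: frame_with_bounds_def h star_le_def)
qed

text \<open>Antisymmetry of the order: the frame bounds put an element and its negative into the
  cone of each \<open>p\<close>, and monotonicity bounds its seminorm by \<open>p 0\<close>.\<close>

lemma normalised_frame_sums:
  assumes frame: "frame_with_bounds act inn 1 1 h"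
  shows "(\<lambda>n. star (coeff n x) * coeff n x) sums inn x x"
proof -
  define S where "S = (\<Sum>n. star (coeff n x) * coeff n x)"
  have sums: "(\<lambda>n. star (coeff n x) * coeff n x) sums S"
    using frame by (simp add: frame_with_bounds_def S_def summable_sums)
  have pos: "positive (S - inn x x)" "positive (inn x x - S)"
    using frame by (auto simp: frame_with_bounds_def S_def star_le_def)
  have "S - inn x x = 0"
  proof (rule pro_cstar_eq_0I)
    fix p :: "'a \<Rightarrow> real"
    assume "p \<in> continuous_cstar_seminorms"
    then interpret cstar_seminormed_star_algebra p
      by (rule cstar_seminormed_star_algebra_if_continuous)
    have "cone (S - inn x x)" "cone (inn x x - S)"
      using pos cone_star_mult by (auto simp: positive_def)
    then have "p (S - inn x x) \<le> p ((S - inn x x) + (inn x x - S))"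
      by (rule p_le_cone_add)
    then show "p (S - inn x x) = 0"
      using p_ge_0 [of "S - inn x x"] by simp
  qed
  then show ?thesis
    using sums by simp
qed

text \<open>The form \<open>f N\<close> belongs to the identity minus the partial sum operator;
  Cauchy-Schwarz for \<open>f N\<close> yields the key estimate.\<close>

lemma reconstruction_if_normalised_frame:
  assumes frame: "frame_with_bounds act inn 1 1 h"
  shows "(\<lambda>n. h n (coeff n x)) sums x"
  unfolding sums_def tendsto_hilbert_module_iff
proof
  fix p :: "'a \<Rightarrow> real"
  assume p: "p \<in> continuous_cstar_seminorms"
  then interpret cstar_seminormed_star_algebra p
    by (rule cstar_seminormed_star_algebra_if_continuous)
  define B where "B N x y = (\<Sum>n<N. star (coeff n x) * coeff n y)" for N x y
  define f where "f N x y = inn x y - B N x y" for N x y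
  have B_lim: "(\<lambda>N. p (B N y y - inn y y)) \<longlonglongrightarrow> 0" for y
    using normalised_frame_sums [OF frame, of y] p
    unfolding sums_def tendsto_pro_cstar_iff B_def by blast
  have B_star: "star (B N y z) = B N z y" for N y z
    by (induction N) (simp_all add: B_def star_add star_mult star_star)
  have f_star: "star (f N y z) = f N z y" for N y z
    by (simp add: f_def star_diff star_inn B_star)
  \<comment> \<open>Up to a \<open>p\<close>-small error, \<open>f N y y\<close> is a finite block
    \<open>B M y y - B N y y\<close> of the series, a sum of elements
    \<open>star b * b\<close>.\<close>
  have cone_f: "cone (f N y y)" for N y
  proof (rule cone_closed)
    fix e :: real
    assume "0 < e"
    then have "\<forall>\<^sub>F M in sequentially. p (B M y y - inn y y) < e"
      using B_lim [of y] by (rule order_tendstoD(2) [rotated])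
    then have "\<forall>\<^sub>F M in sequentially. N \<le> M \<and> p (B M y y - inn y y) < e"
      using eventually_ge_at_top by (rule eventually_conj [rotated])
    then obtain M where M: "N \<le> M" "p (B M y y - inn y y) < e"
      using eventually_happens by force
    have "B M y y - B N y y = (\<Sum>n=N..<M. star (coeff n y) * coeff n y)"
      using M(1) by (simp add: B_def lessThan_atLeast0 sum_diff_nat_ivl)
    then have "cone (B M y y - B N y y)"
      by (simp add: cone_sum cone_star_mult)
    moreover have "p (f N y y - (B M y y - B N y y)) < e"
      using M(2) p_scaleC [of "-1" "B M y y - inn y y"] by (simp add: f_def)
    ultimately show "\<exists>b. cone b \<and> p (f N y y - b) < e"
      by blast
  qed (rule f_star)
  have f_le: "p (f N y y) \<le> p (inn y y)" for N y
    using p_le_cone_add [OF cone_f, of "B N y y" N y]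
    by (simp add: f_def B_def cone_sum cone_star_mult)
  have CS: "(p (f N y z))\<^sup>2 \<le> p (f N y y) * p (f N z z)" for N y z
  proof (rule cauchy_schwarz [OF _ _ _ f_star cone_f])
    show "f N x (y + z) = f N x y + f N x z" for x y z
      by (simp add: f_def B_def inn_add_right multiplier_inn_add h distrib_left sum.distrib)
    show "f N x (c *\<^sub>C y) = c *\<^sub>C f N x y" for x c y
      by (simp add: f_def B_def inn_scaleC_right multiplier_inn_scaleC h mult_scaleC_right
          scaleC.scale_sum_right scaleC.scale_right_diff_distrib)
    show "f N x (act y a) = f N x y * a" for x y a
      by (simp add: f_def B_def inn_act_right multiplier_inn_act h mult.assoc
          sum_distrib_right left_diff_distrib)
  qed
  have "p (inn ((\<Sum>n<N. h n (coeff n x)) - x) ((\<Sum>n<N. h n (coeff n x)) - x))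
      \<le> p (B N x x - inn x x)" for N
  proof -
    define d where "d = (\<Sum>n<N. h n (coeff n x)) - x"
    \<comment> \<open>Thus \<open>inn d d\<close> is, up to sign, a value of the form;
      Cauchy-Schwarz and \<open>f_le\<close> leave a common factor \<open>p (inn d d)\<close> to
      cancel.\<close>
    have "inn d d = - f N x d"
      by (simp add: d_def inn_diff_left inn_partial_sum f_def B_def)
    then have "(p (inn d d))\<^sup>2 = (p (f N x d))\<^sup>2"
      using p_scaleC [of "-1" "f N x d"] by simp
    also have "\<dots> \<le> p (f N x x) * p (f N d d)"
      by (rule CS)
    also have "\<dots> \<le> p (f N x x) * p (inn d d)"
      using f_le by (intro mult_left_mono) simp_all
    finally have "p (inn d d) \<le> p (f N x x)"
      using p_ge_0 [of "f N x x"] p_ge_0 [of "inn d d"]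
      by (cases "p (inn d d) = 0") (simp_all add: power2_eq_square)
    also have "\<dots> = p (B N x x - inn x x)"
      using p_scaleC [of "-1" "f N x x"] by (simp add: f_def)
    finally show ?thesis
      by (simp add: d_def)
  qed
  then show "(\<lambda>N. p (inn ((\<Sum>n<N. h n (coeff n x)) - x) ((\<Sum>n<N. h n (coeff n x)) - x))) \<longlonglongrightarrow> 0"
    by (intro Lim_null_comparison [OF _ B_lim [of x]]) simp
qed

end

theorem theorem3p7:
  fixes act :: "'e::{complex_vector, uniform_space} \<Rightarrow> 'a::pro_cstar_algebra \<Rightarrow> 'e"
    and inn :: "'e \<Rightarrow> 'e \<Rightarrow> 'a"
    and h :: "nat \<Rightarrow> 'a \<Rightarrow> 'e"
  assumes "hilbert_module act inn"
    and "countably_generated_in_multipliers act inn"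
    and "\<And>n. h n \<in> multiplier_module act inn"
  shows "standard_normalised_frame_of_multipliers act inn h \<longleftrightarrow>
    (\<forall>\<xi>. (\<lambda>n. h n (multiplier_inn act inn (h n) \<xi>)) sums \<xi>)"
  unfolding standard_normalised_frame_of_multipliers_def
  using normalised_frame_if_reconstruction [where h = h, OF assms(1,3)]
    reconstruction_if_normalised_frame [where h = h, OF assms(1,3)] by blast

end
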